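(* For $|w|<|z|$, $$\mathsf{K}(z,w)=\frac{\sqrt{zw}}{z-w}\,\frac{J(z)}{J(w)},$$ where $\mathsf{K}(z,w)=\sum_{i,j\in\mathbb{Z}+\frac12}z^iw^{-j}K(i,j)$ is the generating function of the kernel $K$ and $$J(z)=\exp\Big(\sum_{k\ge1}t_kz^k-\sum_{k\ge1}t_k'z^{-k}\Big).$$
   Context: Infinite wedge space. Let $V$ have basis $\{\underline{k}\}_{k\in\mathbb{Z}+1/2}$. The space $\Lambda^{\frac\infty2}V$ has orthonormal basis $v_S=\underline{s_1}\wedge\underline{s_2}\wedge\cdots$, where $S=\{s_1>s_2>\cdots\}\subset\mathbb{Z}+\frac12$ is such that $S\setminus\{-\frac12,-\frac32,\dots\}$ and $\{-\frac12,-\frac32,\dots\}\setminus S$ are finite; $(\cdot,\cdot)$ is the inner product. The vacuum is $v_\emptyset=\underline{-\frac12}\wedge\underline{-\frac32}\wedge\underline{-\frac52}\wedge\cdots$. The operator $\psi_k$ is exterior multiplication $f\mapsto\underline{k}\wedge f$ and $\psi_k^*$ is its adjoint. For $n\ne0$ put $\alpha_n=\sum_{k\in\mathbb{Z}+1/2}\psi_{k-n}\psi_k^*$, and for a sequence $s=(s_1,s_2,\dots)$ put $\Gamma_\pm(s)=\exp\big(\sum_{n\ge1}s_n\alpha_{\pm n}\big)$. Kernel. Let $t=(t_1,t_2,\dots)$, $t'=(t_1',t_2',\dots)$ be parameters; $G=\Gamma_+(t)\,\Gamma_-(t')^{-1}$, $\Psi_k=G\psi_kG^{-1}$, $\Psi_k^*=G\psi_k^*G^{-1}$,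 and $K(i,j)=(\Psi_i\Psi_j^*v_\emptyset,v_\emptyset)$ for $i,j\in\mathbb{Z}+\frac12$. (If $t_k=\frac1k\sum_ix_i^k$, $t'_k=\frac1k\sum_iy_i^k$, then $J(z)=\prod_i\frac{1-y_i/z}{1-x_iz}$.) The treatment is purely algebraic: coefficients are formal power series in the $t_k,t_k'$, and "for $|w|<|z|$" means that $\frac{\sqrt{zw}}{z-w}$ is expanded as $\sum_{j\in\mathbb{Z}_{\ge0}+\frac12}(w/z)^j$. *)

theory Defs
  imports Complex_Main "HOL-Library.Poly_Mapping" "HOL-Library.Product_Plus"
begin

section \<open>Formal power series in arbitrarily many variables\<close>

text \<open>
  A monomial in variables of type \<^typ>\<open>'x\<close> is its exponent vector, of type
  \<^typ>\<open>'x \<Rightarrow>\<^sub>0 nat\<close>.  A power series is an arbitrary family of coefficients indexed by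
  monomials.  The variables are central; the coefficients need not commute.
\<close>

typedef ('x, 'a) mps = "UNIV :: (('x \<Rightarrow>\<^sub>0 nat) \<Rightarrow> 'a) set"
  morphisms coeff Mps ..

lemma coeff_Mps [simp]: "coeff (Mps f) m = f m"
  by (simp add: Mps_inverse)

lemma mps_eqI: "(\<And>m. coeff f m = coeff g m) \<Longrightarrow> f = g"
  by (metis coeff_inject ext)

definition splittings :: "('x \<Rightarrow>\<^sub>0 nat) \<Rightarrow> (('x \<Rightarrow>\<^sub>0 nat) \<times> ('x \<Rightarrow>\<^sub>0 nat)) set"
  where "splittings m = {(a, b). a + b = m}"

lemma finite_splittings: "finite (splittings m)"
proof -
  let ?F = "{f. (\<forall>x\<in>Poly_Mapping.keys m. f x \<in> {..Poly_Mapping.lookup m x}) \<and>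
                (\<forall>x. x \<notin> Poly_Mapping.keys m \<longrightarrow> f x = 0)}"
  have fin: "finite ?F"
    by (rule finite_set_of_finite_funs[THEN finite_subset[rotated],
          of "Poly_Mapping.keys m" "{..Max (insert 0 (Poly_Mapping.lookup m ` Poly_Mapping.keys m))}" _ 0])
       (auto intro: order_trans)
  have "(Poly_Mapping.lookup \<circ> fst) ` splittings m \<subseteq> ?F"
  proof (clarsimp simp: splittings_def, intro conjI ballI allI impI)
    fix a b :: "'a \<Rightarrow>\<^sub>0 nat" and x
    show "Poly_Mapping.lookup a x \<le> Poly_Mapping.lookup (a + b) x"
      by (simp add: lookup_add)
    assume "x \<notin> Poly_Mapping.keys (a + b)"
    then show "Poly_Mapping.lookup a x = 0"
      by (simp add: in_keys_iff lookup_add)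
  qed
  moreover have "inj_on (Poly_Mapping.lookup \<circ> fst) (splittings m)"
    by (auto simp: inj_on_def splittings_def Poly_Mapping.lookup_inject)
  ultimately show ?thesis
    using fin by (meson finite_imageD finite_subset)
qed

instantiation mps :: (type, zero) zero
begin
definition "0 = Mps (\<lambda>_. 0)"
instance ..
end

instantiation mps :: (type, zero_neq_one) one
begin
definition "1 = Mps (\<lambda>m. if m = 0 then 1 else 0)"
instance ..
end

instantiation mps :: (type, plus) plus
begin
definition "f + g = Mps (\<lambda>m. coeff f m + coeff g m)"
instance ..
end

instantiation mps :: (type, minus) minus
begin
definition "f - g = Mps (\<lambda>m. coeff f m - coeff g m)"
instance ..
end

instantiation mps :: (type, uminus) uminus
begin
definition "- f = Mps (\<lambda>m. - coeff f m)"
instance ..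
end

instantiation mps :: (type, semiring_0) times
begin
definition "f * g = Mps (\<lambda>m. \<Sum>(a, b)\<in>splittings m. coeff f a * coeff g b)"
instance ..
end

instantiation mps :: (type, scaleR) scaleR
begin
definition "scaleR r f = Mps (\<lambda>m. scaleR r (coeff f m))"
instance ..
end

lemma coeff_zero [simp]: "coeff 0 m = 0"
  by (simp add: zero_mps_def)

lemma coeff_one: "coeff 1 m = (if m = 0 then 1 else 0)"
  by (simp add: one_mps_def)

lemma coeff_add [simp]: "coeff (f + g) m = coeff f m + coeff g m"
  by (simp add: plus_mps_def)

lemma coeff_diff [simp]: "coeff (f - g) m = coeff f m - coeff g m"
  by (simp add: minus_mps_def)

lemma coeff_uminus [simp]: "coeff (- f) m = - coeff f m"
  by (simp add: uminus_mps_def)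

lemma coeff_mult: "coeff (f * g) m = (\<Sum>(a, b)\<in>splittings m. coeff f a * coeff g b)"
  by (simp add: times_mps_def)

lemma coeff_scaleR [simp]: "coeff (scaleR r f) m = scaleR r (coeff f m)"
  by (simp add: scaleR_mps_def)

instance mps :: (type, ab_group_add) ab_group_add
  by standard (auto intro: mps_eqI)

instance mps :: (type, ring_1) ring_1
proof
  fix f g h :: "('a, 'b) mps"
  show "f * g * h = f * (g * h)"
  proof (rule mps_eqI)
    fix m
    have "coeff (f * g * h) m =
        (\<Sum>((s, c), (a, b))\<in>(SIGMA p:splittings m. splittings (fst p)). coeff f a * coeff g b * coeff h c)"
      by (simp add: coeff_mult sum_distrib_right case_prod_beta sum.Sigma finite_splittings)
    also have "\<dots> =
        (\<Sum>((a, s), (b, c))\<in>(SIGMA p:splittings m. splittings (snd p)). coeff f a * (coeff g b * coeff h c))"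
      by (rule sum.reindex_bij_witness
            [where i = "\<lambda>((a, s), (b, c)). ((a + b, c), (a, b))"
               and j = "\<lambda>((s, c), (a, b)). ((a, b + c), (b, c))"])
         (auto simp: splittings_def algebra_simps)
    also have "\<dots> = coeff (f * (g * h)) m"
      by (simp add: coeff_mult sum_distrib_left case_prod_beta sum.Sigma finite_splittings)
    finally show "coeff (f * g * h) m = coeff (f * (g * h)) m" .
  qed
  show "(f + g) * h = f * h + g * h" "f * (g + h) = f * g + f * h"
    by (auto intro!: mps_eqI
        simp: coeff_mult distrib_left distrib_right case_prod_beta sum.distrib)
  show "1 * f = f"
  proof (rule mps_eqI)
    fix m
    have "coeff (1 * f) m = (\<Sum>p\<in>splittings m. if p = (0, m) then coeff f m else 0)"
      unfolding coeff_mult by (rule sum.cong) (auto simp: splittings_def coeff_one split: if_splits)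
    also have "\<dots> = coeff f m"
      by (simp add: sum.delta finite_splittings) (simp add: splittings_def)
    finally show "coeff (1 * f) m = coeff f m" .
  qed
  show "f * 1 = f"
  proof (rule mps_eqI)
    fix m
    have "coeff (f * 1) m = (\<Sum>p\<in>splittings m. if p = (m, 0) then coeff f m else 0)"
      unfolding coeff_mult by (rule sum.cong) (auto simp: splittings_def coeff_one split: if_splits)
    also have "\<dots> = coeff f m"
      by (simp add: sum.delta finite_splittings) (simp add: splittings_def)
    finally show "coeff (f * 1) m = coeff f m" .
  qed
  show "(0 :: ('a, 'b) mps) \<noteq> 1"
    by (metis coeff_one coeff_zero zero_neq_one)
qed

instance mps :: (type, comm_ring_1) comm_ring_1
proof
  fix f g :: "('a, 'b) mps"
  show "f * g = g * f"
  proof (rule mps_eqI)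
    fix m
    show "coeff (f * g) m = coeff (g * f) m"
      unfolding coeff_mult
      by (rule sum.reindex_bij_witness[where i = prod.swap and j = prod.swap])
         (auto simp: splittings_def algebra_simps)
  qed
qed (simp_all add: distrib_right)

instance mps :: (type, real_vector) real_vector
  by standard (auto intro: mps_eqI simp: algebra_simps)

instance mps :: (type, real_algebra_1) real_algebra_1
  by standard (auto intro!: mps_eqI simp: coeff_mult scaleR_sum_right case_prod_beta)

definition mps_const :: "'a::zero \<Rightarrow> ('x, 'a) mps"
  where "mps_const a = Mps (\<lambda>m. if m = 0 then a else 0)"

definition mps_var :: "'x \<Rightarrow> ('x, 'a::zero_neq_one) mps"
  where "mps_var x = Mps (\<lambda>m. if m = Poly_Mapping.single x 1 then 1 else 0)"

text \<open>
  Sum of a possibly infinite family in which every monomial occurs in only finitely many members.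
\<close>

definition mps_suminf :: "'i set \<Rightarrow> ('i \<Rightarrow> ('x, 'a::comm_monoid_add) mps) \<Rightarrow> ('x, 'a) mps"
  where "mps_suminf I f = Mps (\<lambda>m. \<Sum>i | i \<in> I \<and> coeff (f i) m \<noteq> 0. coeff (f i) m)"

text \<open>
  Only meaningful for \<^term>\<open>f\<close> with zero constant term: then \<^term>\<open>f ^ k\<close> has no monomial
  of degree less than \<^term>\<open>k\<close>, so that the family is locally finite.
\<close>

definition mps_exp :: "('x, 'a::real_algebra_1) mps \<Rightarrow> ('x, 'a) mps"
  where "mps_exp f = mps_suminf UNIV (\<lambda>k. f ^ k /\<^sub>R fact k)"

definition ring_inverse :: "'a::monoid_mult \<Rightarrow> 'a"
  where "ring_inverse x = (THE y. x * y = 1 \<and> y * x = 1)"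


section \<open>The infinite wedge space\<close>

definition half_ints :: "rat set"
  where "half_ints = range (\<lambda>n::int. of_int n + 1 / 2)"

definition neg_half_ints :: "rat set"
  where "neg_half_ints = {k \<in> half_ints. k < 0}"

typedef maya = "{S. S \<subseteq> half_ints \<and> finite (S - neg_half_ints) \<and> finite (neg_half_ints - S)}"
  morphisms maya_set Maya
  by (rule exI[of _ neg_half_ints]) (auto simp: neg_half_ints_def)

text \<open>
  The vectors are the finite linear combinations of the $v_S$, over the complex numbers; the inner
  product is Hermitian, linear in its first argument.
\<close>

type_synonym wedge = "maya \<Rightarrow>\<^sub>0 complex"

definition wedge_scale :: "complex \<Rightarrow> wedge \<Rightarrow> wedge"
  where "wedge_scale c f = Poly_Mapping.map ((*) c) f"

definition wedge_basis :: "maya \<Rightarrow> wedge"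
  where "wedge_basis S = Poly_Mapping.single S 1"

definition vacuum :: wedge
  where "vacuum = wedge_basis (Maya neg_half_ints)"

definition wedge_inner :: "wedge \<Rightarrow> wedge \<Rightarrow> complex"
  where "wedge_inner f g =
    (\<Sum>S\<in>Poly_Mapping.keys f. Poly_Mapping.lookup f S * cnj (Poly_Mapping.lookup g S))"

lemma lookup_wedge_scale [simp]:
  "Poly_Mapping.lookup (wedge_scale c f) S = c * Poly_Mapping.lookup f S"
  unfolding wedge_scale_def by transfer (simp add: when_def)

lemma vector_space_wedge_scale: "vector_space wedge_scale"
  by standard (auto intro!: poly_mapping_eqI simp: lookup_add algebra_simps)

lemma linear_wedge_iff:
  "Vector_Spaces.linear wedge_scale wedge_scale A \<longleftrightarrow>
     (\<forall>f g. A (f + g) = A f + A g) \<and> (\<forall>c f. A (wedge_scale c f) = wedge_scale c (A f))"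
  unfolding Vector_Spaces.linear_def module_hom_def module_hom_axioms_def
  using vector_space_wedge_scale by (auto simp: module_iff_vector_space)

lemma wedge_inner_eq:
  assumes "finite A" "Poly_Mapping.keys f \<subseteq> A"
  shows "wedge_inner f g =
    (\<Sum>S\<in>A. Poly_Mapping.lookup f S * cnj (Poly_Mapping.lookup g S))"
  unfolding wedge_inner_def using assms
  by (intro sum.mono_neutral_left) (auto simp: in_keys_iff)

lemma wedge_inner_basis_left [simp]:
  "wedge_inner (wedge_basis S) g = cnj (Poly_Mapping.lookup g S)"
  by (simp add: wedge_inner_def wedge_basis_def)

lemma wedge_inner_basis_right [simp]:
  "wedge_inner f (wedge_basis S) = Poly_Mapping.lookup f S"
proof -
  have "wedge_inner f (wedge_basis S) =
      (\<Sum>T\<in>Poly_Mapping.keys f. if T = S then Poly_Mapping.lookup f S else 0)"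
    unfolding wedge_inner_def wedge_basis_def
    by (rule sum.cong) (auto simp: lookup_single when_def)
  then show ?thesis
    by (simp add: sum.delta in_keys_iff)
qed

lemma wedge_basis_orthonormal:
  "wedge_inner (wedge_basis S) (wedge_basis T) = (if S = T then 1 else 0)"
  unfolding wedge_inner_basis_right by (simp add: wedge_basis_def lookup_single when_def)


section \<open>Operators\<close>

typedef wedge_op = "{A. Vector_Spaces.linear wedge_scale wedge_scale A}"
  morphisms op_apply Wedge_op
  by (rule exI[of _ id]) (simp add: linear_wedge_iff)

setup_lifting type_definition_wedge_op

lemma op_apply_add: "op_apply A (f + g) = op_apply A f + op_apply A g"
  and op_apply_scale: "op_apply A (wedge_scale c f) = wedge_scale c (op_apply A f)"
  using op_apply[of A] by (auto simp: linear_wedge_iff)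

instantiation wedge_op :: ring_1
begin
lift_definition zero_wedge_op :: wedge_op is "\<lambda>_. 0"
  by (auto simp: linear_wedge_iff intro!: poly_mapping_eqI)
lift_definition one_wedge_op :: wedge_op is "\<lambda>f. f"
  by (auto simp: linear_wedge_iff)
lift_definition plus_wedge_op :: "wedge_op \<Rightarrow> wedge_op \<Rightarrow> wedge_op" is "\<lambda>A B f. A f + B f"
  by (auto simp: linear_wedge_iff lookup_add algebra_simps intro!: poly_mapping_eqI)
lift_definition minus_wedge_op :: "wedge_op \<Rightarrow> wedge_op \<Rightarrow> wedge_op" is "\<lambda>A B f. A f - B f"
  by (auto simp: linear_wedge_iff lookup_add lookup_minus right_diff_distrib intro!: poly_mapping_eqI)
lift_definition uminus_wedge_op :: "wedge_op \<Rightarrow> wedge_op" is "\<lambda>A f. - A f"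
  by (auto simp: linear_wedge_iff algebra_simps intro!: poly_mapping_eqI)
lift_definition times_wedge_op :: "wedge_op \<Rightarrow> wedge_op \<Rightarrow> wedge_op" is "\<lambda>A B f. A (B f)"
  by (auto simp: linear_wedge_iff)
instance
proof
  show "(0 :: wedge_op) \<noteq> 1"
  proof
    assume "(0 :: wedge_op) = 1"
    then have "(0 :: wedge) = vacuum"
      by transfer (rule fun_cong)
    then have "Poly_Mapping.lookup 0 (Maya neg_half_ints) =
        Poly_Mapping.lookup vacuum (Maya neg_half_ints)"
      by simp
    then show False
      by (simp add: vacuum_def wedge_basis_def)
  qed
qed (transfer; simp add: linear_wedge_iff fun_eq_iff algebra_simps)+
end

instantiation wedge_op :: real_algebra_1
begin
lift_definition scaleR_wedge_op :: "real \<Rightarrow> wedge_op \<Rightarrow> wedge_op"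
  is "\<lambda>r A f. wedge_scale (of_real r) (A f)"
  by (auto simp: linear_wedge_iff lookup_add algebra_simps intro!: poly_mapping_eqI)
instance
  by standard
     (transfer; auto simp: linear_wedge_iff fun_eq_iff lookup_add algebra_simps intro!: poly_mapping_eqI)+
end

lemma wedge_op_eqI: "(\<And>f. op_apply A f = op_apply B f) \<Longrightarrow> A = B"
  by (metis op_apply_inject ext)

definition basis_extend :: "(maya \<Rightarrow> wedge) \<Rightarrow> wedge \<Rightarrow> wedge"
  where "basis_extend b f =
    (\<Sum>S\<in>Poly_Mapping.keys f. wedge_scale (Poly_Mapping.lookup f S) (b S))"

lemma lookup_basis_extend:
  assumes "finite A" "Poly_Mapping.keys f \<subseteq> A"
  shows "Poly_Mapping.lookup (basis_extend b f) T =
    (\<Sum>S\<in>A. Poly_Mapping.lookup f S * Poly_Mapping.lookup (b S) T)"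
  unfolding basis_extend_def lookup_sum lookup_wedge_scale using assms
  by (intro sum.mono_neutral_left) (auto simp: in_keys_iff)

lemma linear_basis_extend: "Vector_Spaces.linear wedge_scale wedge_scale (basis_extend b)"
  unfolding linear_wedge_iff
proof (intro conjI allI poly_mapping_eqI)
  fix f g :: wedge and c T
  let ?A = "Poly_Mapping.keys f \<union> Poly_Mapping.keys g \<union> Poly_Mapping.keys (f + g)"
  show "Poly_Mapping.lookup (basis_extend b (f + g)) T =
      Poly_Mapping.lookup (basis_extend b f + basis_extend b g) T"
    using lookup_basis_extend[of ?A f b T] lookup_basis_extend[of ?A g b T]
      lookup_basis_extend[of ?A "f + g" b T]
    by (simp add: lookup_add sum.distrib distrib_right subset_eq)
  have "Poly_Mapping.keys (wedge_scale c f) \<subseteq> Poly_Mapping.keys f"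
    by (auto simp: in_keys_iff)
  then show "Poly_Mapping.lookup (basis_extend b (wedge_scale c f)) T =
      Poly_Mapping.lookup (wedge_scale c (basis_extend b f)) T"
    by (simp add: lookup_basis_extend[of "Poly_Mapping.keys f"] sum_distrib_left algebra_simps)
qed

text \<open>
  Reordering $k \wedge s_1 \wedge s_2 \wedge \cdots$ decreasingly moves $k$ past those elements of
  the set that exceed it.  Only used for half-integers \<^term>\<open>k\<close>.
\<close>

definition wedge_insert :: "rat \<Rightarrow> maya \<Rightarrow> wedge"
  where "wedge_insert k S =
    (if k \<in> maya_set S then 0
     else wedge_scale ((- 1) ^ card {s \<in> maya_set S. k < s}) (wedge_basis (Maya (insert k (maya_set S)))))"


lift_definition psi :: "rat \<Rightarrow> wedge_op" is "\<lambda>k. basis_extend (wedge_insert k)"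
  by (rule linear_basis_extend)

definition is_adjoint :: "wedge_op \<Rightarrow> wedge_op \<Rightarrow> bool"
  where "is_adjoint A B \<longleftrightarrow> (\<forall>f g. wedge_inner (op_apply A f) g = wedge_inner f (op_apply B g))"

definition op_adjoint :: "wedge_op \<Rightarrow> wedge_op"
  where "op_adjoint A = (THE B. is_adjoint A B)"

definition psi_star :: "rat \<Rightarrow> wedge_op"
  where "psi_star k = op_adjoint (psi k)"

text \<open>
  Only used for \<^term>\<open>n \<noteq> 0\<close>; the sum over \<^term>\<open>k\<close> is then finite on each vector.
\<close>

definition alpha :: "int \<Rightarrow> wedge_op"
  where "alpha n = Wedge_op (\<lambda>f.
    \<Sum>k | k \<in> half_ints \<and> op_apply (psi (k - of_int n) * psi_star k) f \<noteq> 0.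
      op_apply (psi (k - of_int n) * psi_star k) f)"


subsection \<open>The adjoint and the sums above are well-defined\<close>

lemma is_adjoint_unique:
  assumes "is_adjoint A B" "is_adjoint A C"
  shows "B = C"
proof (rule wedge_op_eqI, rule poly_mapping_eqI)
  fix f S
  have "wedge_inner (wedge_basis S) (op_apply B f) = wedge_inner (wedge_basis S) (op_apply C f)"
    using assms by (metis is_adjoint_def)
  then show "Poly_Mapping.lookup (op_apply B f) S = Poly_Mapping.lookup (op_apply C f) S"
    by simp
qed

lemma op_adjoint_eqI: "is_adjoint A B \<Longrightarrow> op_adjoint A = B"
  unfolding op_adjoint_def using is_adjoint_unique by blast

lift_definition psi_star_explicit :: "rat \<Rightarrow> wedge_op" is
  "\<lambda>k. basis_extend (\<lambda>S.
     if k \<in> maya_set S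
     then wedge_scale ((- 1) ^ card {s \<in> maya_set S. k < s}) (wedge_basis (Maya (maya_set S - {k})))
     else 0)"
  by (rule linear_basis_extend)

lemma maya_insert: "k \<in> half_ints \<Longrightarrow> maya_set (Maya (insert k (maya_set S))) = insert k (maya_set S)"
proof (subst Maya_inverse)
  assume k: "k \<in> half_ints"
  have "neg_half_ints - insert k (maya_set S) \<subseteq> neg_half_ints - maya_set S"
    "insert k (maya_set S) - neg_half_ints \<subseteq> insert k (maya_set S - neg_half_ints)"
    by auto
  with k show "insert k (maya_set S) \<in>
      {S. S \<subseteq> half_ints \<and> finite (S - neg_half_ints) \<and> finite (neg_half_ints - S)}"
    using maya_set[of S] by (auto intro: finite_subset)
qed auto

lemma maya_remove: "maya_set (Maya (maya_set S - {k})) = maya_set S - {k}"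
proof (subst Maya_inverse)
  have "neg_half_ints - (maya_set S - {k}) \<subseteq> insert k (neg_half_ints - maya_set S)"
    "maya_set S - {k} - neg_half_ints \<subseteq> maya_set S - neg_half_ints"
    by auto
  then show "maya_set S - {k} \<in>
      {S. S \<subseteq> half_ints \<and> finite (S - neg_half_ints) \<and> finite (neg_half_ints - S)}"
    using maya_set[of S] by (auto intro: finite_subset)
qed auto

lemma psi_star_matrix:
  assumes k: "k \<in> half_ints"
  shows "Poly_Mapping.lookup (wedge_insert k S) T =
    cnj (Poly_Mapping.lookup
      (if k \<in> maya_set T
       then wedge_scale ((- 1) ^ card {s \<in> maya_set T. k < s}) (wedge_basis (Maya (maya_set T - {k})))
       else 0) S)"
proof -
  have "(k \<notin> maya_set S \<and> Maya (insert k (maya_set S)) = T) \<longleftrightarrow>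
      (k \<in> maya_set T \<and> Maya (maya_set T - {k}) = S)"
    using maya_insert[OF k, of S] maya_remove[of T k]
    by (metis Diff_insert_absorb Diff_iff insert_Diff insertI1 maya_set_inverse)
  moreover have "card {s \<in> maya_set S. k < s} = card {s \<in> maya_set T. k < s}"
    if "Maya (insert k (maya_set S)) = T"
    using that maya_insert[OF k, of S] by (intro arg_cong[where f = card]) auto
  ultimately show ?thesis
    by (auto simp: wedge_insert_def wedge_basis_def lookup_single when_def)
qed

lemma psi_star_eq:
  assumes k: "k \<in> half_ints"
  shows "psi_star k = psi_star_explicit k"
  unfolding psi_star_def
proof (rule op_adjoint_eqI, unfold is_adjoint_def, intro allI)
  fix f g :: wedge
  let ?c = "\<lambda>T. if k \<in> maya_set T
       then wedge_scale ((- 1) ^ card {s \<in> maya_set T. k < s}) (wedge_basis (Maya (maya_set T - {k})))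
       else 0"
  let ?b = "wedge_insert k"
  let ?K = "Poly_Mapping.keys"
  let ?l = "Poly_Mapping.lookup"
  let ?A = "?K (basis_extend ?b f) \<union> ?K g"
  have "wedge_inner (basis_extend ?b f) g = (\<Sum>T\<in>?A. ?l (basis_extend ?b f) T * cnj (?l g T))"
    by (rule wedge_inner_eq) auto
  also have "\<dots> = (\<Sum>T\<in>?K g. ?l (basis_extend ?b f) T * cnj (?l g T))"
    by (rule sum.mono_neutral_right) (auto simp: in_keys_iff)
  also have "\<dots> = (\<Sum>T\<in>?K g. \<Sum>S\<in>?K f. ?l f S * ?l (?b S) T * cnj (?l g T))"
    by (simp add: lookup_basis_extend[OF finite_keys subset_refl] sum_distrib_right)
  also have "\<dots> = (\<Sum>S\<in>?K f. \<Sum>T\<in>?K g. ?l f S * cnj (?l g T * ?l (?c T) S))"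
    by (subst sum.swap) (simp only: psi_star_matrix[OF k] complex_cnj_mult mult_ac)
  also have "\<dots> = wedge_inner f (basis_extend ?c g)"
    unfolding wedge_inner_def lookup_basis_extend[OF finite_keys subset_refl]
    by (simp only: sum_distrib_left cnj_sum)
  finally show "wedge_inner (op_apply (psi k) f) g = wedge_inner f (op_apply (psi_star_explicit k) g)"
    by (simp add: psi.rep_eq psi_star_explicit.rep_eq)
qed

lemma op_apply_zero: "op_apply A 0 = 0"
  using op_apply_add[of A 0 0] by simp

lemma op_apply_sum: "op_apply A (\<Sum>i\<in>I. g i) = (\<Sum>i\<in>I. op_apply A (g i))"
  by (induction I rule: infinite_finite_induct) (auto simp: op_apply_zero op_apply_add)

lemma wedge_expand:
  "f = (\<Sum>S\<in>Poly_Mapping.keys f. wedge_scale (Poly_Mapping.lookup f S) (wedge_basis S))"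
proof (rule poly_mapping_eqI)
  fix T
  have "Poly_Mapping.lookup
      (\<Sum>S\<in>Poly_Mapping.keys f. wedge_scale (Poly_Mapping.lookup f S) (wedge_basis S)) T =
      (\<Sum>S\<in>Poly_Mapping.keys f. if S = T then Poly_Mapping.lookup f T else 0)"
    unfolding lookup_sum
    by (rule sum.cong) (auto simp: wedge_basis_def lookup_single when_def)
  then show "Poly_Mapping.lookup f T = Poly_Mapping.lookup
      (\<Sum>S\<in>Poly_Mapping.keys f. wedge_scale (Poly_Mapping.lookup f S) (wedge_basis S)) T"
    by (simp add: sum.delta in_keys_iff)
qed

lemma wedge_scale_zero [simp]: "wedge_scale c 0 = 0"
  by (rule poly_mapping_eqI) simp

lemma wedge_scale_sum: "wedge_scale c (\<Sum>i\<in>I. g i) = (\<Sum>i\<in>I. wedge_scale c (g i))"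
  by (rule poly_mapping_eqI) (simp add: lookup_sum sum_distrib_left)

lemma basis_extend_basis [simp]: "basis_extend b (wedge_basis S) = b S"
proof (rule poly_mapping_eqI)
  fix T
  show "Poly_Mapping.lookup (basis_extend b (wedge_basis S)) T = Poly_Mapping.lookup (b S) T"
    by (simp add: lookup_basis_extend[of "{S}"] wedge_basis_def)
qed

lemma finite_half_ints_between: "finite {k \<in> half_ints. a < k \<and> k < b}"
proof (rule finite_subset)
  show "{k \<in> half_ints. a < k \<and> k < b} \<subseteq> (\<lambda>n. of_int n + 1 / 2) ` {\<lfloor>a\<rfloor> - 1..\<lceil>b\<rceil>}"
  proof (clarsimp simp: half_ints_def image_iff)
    fix n :: int
    assume "a < of_int n + 1 / 2" "of_int n + 1 / 2 < b"
    then show "\<lfloor>a\<rfloor> - 1 \<le> n \<and> n \<le> \<lceil>b\<rceil>"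
      by linarith
  qed
qed simp

lemma half_ints_diff: "k \<in> half_ints \<Longrightarrow> k - of_int n \<in> half_ints"
proof -
  assume "k \<in> half_ints"
  then obtain l :: int where "k = of_int l + 1 / 2"
    by (auto simp: half_ints_def)
  then show ?thesis
    unfolding half_ints_def by (intro image_eqI[of _ _ "l - n"]) auto
qed

lemma finite_alpha_summands:
  assumes n: "n \<noteq> 0"
  shows "finite {k \<in> half_ints. op_apply (psi (k - of_int n) * psi_star k) f \<noteq> 0}"
proof (rule finite_subset)
  let ?X = "\<lambda>S. {k \<in> half_ints. k \<in> maya_set S \<and> k - of_int n \<notin> maya_set S}"
  show "{k \<in> half_ints. op_apply (psi (k - of_int n) * psi_star k) f \<noteq> 0} \<subseteq>
      (\<Union>S\<in>Poly_Mapping.keys f. ?X S)"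
  proof clarsimp
    fix k
    assume k: "k \<in> half_ints" and nz: "op_apply (psi (k - of_int n) * psi_star k) f \<noteq> 0"
    let ?P = "psi (k - of_int n) * psi_star k"
    have "op_apply ?P f =
        (\<Sum>S\<in>Poly_Mapping.keys f. wedge_scale (Poly_Mapping.lookup f S) (op_apply ?P (wedge_basis S)))"
      by (subst wedge_expand) (simp add: op_apply_sum op_apply_scale)
    then obtain S where S: "S \<in> Poly_Mapping.keys f" "op_apply ?P (wedge_basis S) \<noteq> 0"
      using nz by (metis (mono_tags, lifting) sum.neutral wedge_scale_zero)
    have "k \<in> maya_set S"
    proof (rule ccontr)
      assume "k \<notin> maya_set S"
      then have "op_apply (psi_star k) (wedge_basis S) = 0"
        by (simp add: psi_star_eq[OF k] psi_star_explicit.rep_eq)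
      with S(2) show False
        by (simp add: times_wedge_op.rep_eq op_apply_zero)
    qed
    moreover have "k - of_int n \<notin> maya_set S"
    proof
      assume "k - of_int n \<in> maya_set S"
      then have "op_apply (psi (k - of_int n)) (wedge_basis (Maya (maya_set S - {k}))) = 0"
        using n by (simp add: psi.rep_eq wedge_insert_def maya_remove)
      then have "op_apply ?P (wedge_basis S) = 0"
        using \<open>k \<in> maya_set S\<close>
        by (simp add: times_wedge_op.rep_eq psi_star_eq[OF k] psi_star_explicit.rep_eq op_apply_scale)
      with S(2) show False
        by simp
    qed
    ultimately have "k \<in> maya_set S \<and> k - of_int n \<notin> maya_set S"
      by simp
    with S(1) show "\<exists>S\<in>Poly_Mapping.keys f. k \<in> maya_set S \<and> k - of_int n \<notin> maya_set S"
      by blast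
  qed
  have "finite (?X S)" for S
  proof (rule finite_subset)
    show "?X S \<subseteq> (maya_set S - neg_half_ints) \<union>
        (\<lambda>k. k + of_int n) ` (neg_half_ints - maya_set S) \<union>
        {k \<in> half_ints. of_int n - 1 < k \<and> k < 0}"
    proof
      fix k
      assume k: "k \<in> ?X S"
      then have h: "k - of_int n \<in> half_ints"
        by (simp add: half_ints_diff)
      consider "0 \<le> k" | "k < 0" "k - of_int n < 0" | "k < 0" "0 \<le> k - of_int n"
        by linarith
      then show "k \<in> (maya_set S - neg_half_ints) \<union>
          (\<lambda>k. k + of_int n) ` (neg_half_ints - maya_set S) \<union>
          {k \<in> half_ints. of_int n - 1 < k \<and> k < 0}"
      proof cases
        case 1
        with k show ?thesis
          by (simp add: neg_half_ints_def)
      next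
        case 2
        with k h have "k - of_int n \<in> neg_half_ints - maya_set S"
          by (simp add: neg_half_ints_def)
        then have "k - of_int n + of_int n \<in> (\<lambda>k. k + of_int n) ` (neg_half_ints - maya_set S)"
          by (rule imageI)
        then show ?thesis
          by simp
      next
        case 3
        with k show ?thesis
          by simp
      qed
    qed
    show "finite ((maya_set S - neg_half_ints) \<union>
        (\<lambda>k. k + of_int n) ` (neg_half_ints - maya_set S) \<union>
        {k \<in> half_ints. of_int n - 1 < k \<and> k < 0})"
      using maya_set[of S] finite_half_ints_between by auto
  qed
  then show "finite (\<Union>S\<in>Poly_Mapping.keys f. ?X S)"
    by simp
qed

lemma alpha_apply:
  assumes n: "n \<noteq> 0"
  shows "op_apply (alpha n) f =
    (\<Sum>k | k \<in> half_ints \<and> op_apply (psi (k - of_int n) * psi_star k) f \<noteq> 0.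
      op_apply (psi (k - of_int n) * psi_star k) f)"
proof -
  let ?P = "\<lambda>k. op_apply (psi (k - of_int n) * psi_star k)"
  let ?N = "\<lambda>f. {k. k \<in> half_ints \<and> ?P k f \<noteq> 0}"
  let ?s = "\<lambda>f. \<Sum>k\<in>?N f. ?P k f"
  have sup: "?s f = (\<Sum>k\<in>A. ?P k f)" if "finite A" "A \<subseteq> half_ints" "?N f \<subseteq> A" for f A
    using that by (intro sum.mono_neutral_left) auto
  note fin = finite_alpha_summands[OF n]
  have "?s (f + g) = ?s f + ?s g" for f g
  proof -
    let ?A = "?N f \<union> ?N g \<union> ?N (f + g)"
    have "?s (f + g) = (\<Sum>k\<in>?A. ?P k (f + g))" "?s f = (\<Sum>k\<in>?A. ?P k f)"
      "?s g = (\<Sum>k\<in>?A. ?P k g)"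
      using fin by (intro sup; blast)+
    then show ?thesis
      by (simp add: op_apply_add sum.distrib)
  qed
  moreover have "?s (wedge_scale c f) = wedge_scale c (?s f)" for c f
  proof -
    let ?A = "?N f \<union> ?N (wedge_scale c f)"
    have "?s (wedge_scale c f) = (\<Sum>k\<in>?A. ?P k (wedge_scale c f))" "?s f = (\<Sum>k\<in>?A. ?P k f)"
      using fin by (intro sup; blast)+
    then show ?thesis
      by (simp only: op_apply_scale wedge_scale_sum)
  qed
  ultimately have "Vector_Spaces.linear wedge_scale wedge_scale ?s"
    by (simp add: linear_wedge_iff)
  then show ?thesis
    unfolding alpha_def by (simp add: Wedge_op_inverse)
qed


section \<open>The kernel\<close>

text \<open>
  \<open>T n\<close> and \<open>T' n\<close> are the variables $t_n$ and $t'_n$ for $n \geq 1$; \<open>T 0\<close> and \<open>T' 0\<close> never occur.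
  Vectors and operators with coefficients in power series in these variables are power series
  whose coefficients are vectors and operators.
\<close>

datatype param = T nat | T' nat

definition Gamma_plus :: "(nat \<Rightarrow> (param, wedge_op) mps) \<Rightarrow> (param, wedge_op) mps"
  where "Gamma_plus s = mps_exp (mps_suminf {1..} (\<lambda>n. s n * mps_const (alpha (int n))))"

definition Gamma_minus :: "(nat \<Rightarrow> (param, wedge_op) mps) \<Rightarrow> (param, wedge_op) mps"
  where "Gamma_minus s = mps_exp (mps_suminf {1..} (\<lambda>n. s n * mps_const (alpha (- int n))))"

definition G_op :: "(param, wedge_op) mps"
  where "G_op = Gamma_plus (\<lambda>n. mps_var (T n)) * ring_inverse (Gamma_minus (\<lambda>n. mps_var (T' n)))"

definition Psi :: "rat \<Rightarrow> (param, wedge_op) mps"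
  where "Psi k = G_op * mps_const (psi k) * ring_inverse G_op"

definition Psi_star :: "rat \<Rightarrow> (param, wedge_op) mps"
  where "Psi_star k = G_op * mps_const (psi_star k) * ring_inverse G_op"

text \<open>The inner product with the vacuum is extended coefficientwise to power series of vectors.\<close>

definition kernel_K :: "rat \<Rightarrow> rat \<Rightarrow> (param, complex) mps"
  where "kernel_K i j = Mps (\<lambda>m. wedge_inner (op_apply (coeff (Psi i * Psi_star j) m) vacuum) vacuum)"


section \<open>Generating functions\<close>

text \<open>
  A two-sided formal series in $z$ and $w$, with rational exponents and coefficients in a ring
  of power series, is the function sending \<open>(a, b)\<close> to the coefficient of $z^a w^b$.
\<close>

definition kernel_gf :: "rat \<times> rat \<Rightarrow> (param, complex) mps"
  where "kernel_gf = (\<lambda>(a, b).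
    if a \<in> half_ints \<and> b \<in> half_ints then kernel_K a (- b) else 0)"

text \<open>The expansion $\sum_j (w/z)^j$ over positive half-integers $j$.\<close>

definition sqrt_zw_over_diff :: "rat \<times> rat \<Rightarrow> complex"
  where "sqrt_zw_over_diff = (\<lambda>(a, b). if b \<in> half_ints \<and> 0 < b \<and> a = - b then 1 else 0)"

text \<open>It satisfies $(z - w) \cdot \sum_j (w/z)^j = z^{1/2} w^{1/2}$.\<close>

lemma sqrt_zw_over_diff:
  "sqrt_zw_over_diff (a - 1, b) - sqrt_zw_over_diff (a, b - 1) =
    (if a = 1 / 2 \<and> b = 1 / 2 then 1 else 0)"
proof -
  have shift: "b - 1 \<in> half_ints \<longleftrightarrow> b \<in> half_ints"
    using half_ints_diff[of b 1] half_ints_diff[of "b - 1" "-1"] by fastforce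
  have small: "b = 1 / 2" if b: "b \<in> half_ints" "0 < b" "\<not> 0 < b - 1"
  proof -
    obtain n :: int where n: "b = of_int n + 1 / 2"
      using b(1) by (auto simp: half_ints_def)
    have "(- 1 :: rat) < of_int n" "of_int n < (1 :: rat)"
      using b(2,3) n by linarith+
    then have "n = 0"
      by linarith
    with n show ?thesis
      by simp
  qed
  have "(1 / 2 :: rat) \<in> half_ints"
    unfolding half_ints_def by (rule image_eqI[of _ _ 0]) auto
  with shift small show ?thesis
    unfolding sqrt_zw_over_diff_def by (cases "b = 1 / 2"; cases "a = 1 - b") fastforce+
qed

text \<open>Laurent polynomials in $z$ and $w$.\<close>

type_synonym laurent = "(rat \<times> rat) \<Rightarrow>\<^sub>0 complex"

instantiation poly_mapping :: (type, real_vector) real_vector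
begin
definition scaleR_poly_mapping :: "real \<Rightarrow> ('a \<Rightarrow>\<^sub>0 'b) \<Rightarrow> ('a \<Rightarrow>\<^sub>0 'b)"
  where "scaleR_poly_mapping r f = Poly_Mapping.map (scaleR r) f"
lemma lookup_scaleR [simp]:
  "Poly_Mapping.lookup (scaleR r f) x = scaleR r (Poly_Mapping.lookup (f :: 'a \<Rightarrow>\<^sub>0 'b) x)"
  unfolding scaleR_poly_mapping_def by transfer (simp add: when_def)
instance
  by standard (auto intro!: poly_mapping_eqI simp: lookup_add algebra_simps)
end

lemma lookup_mult_superset:
  fixes f g :: "'a::monoid_add \<Rightarrow>\<^sub>0 'b::semiring_0"
  assumes "finite A" "Poly_Mapping.keys f \<subseteq> A" "finite B" "Poly_Mapping.keys g \<subseteq> B"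
  shows "Poly_Mapping.lookup (f * g) k =
    (\<Sum>a\<in>A. \<Sum>b\<in>B. Poly_Mapping.lookup f a * Poly_Mapping.lookup g b when k = a + b)"
proof -
  have "Sum_any (\<lambda>q. Poly_Mapping.lookup g q when k = a + q) =
      (\<Sum>q\<in>B. Poly_Mapping.lookup g q when k = a + q)" for a
    using assms by (intro Sum_any.expand_superset) (auto simp: when_def in_keys_iff)
  moreover have "Sum_any (\<lambda>a. Poly_Mapping.lookup f a * h a) = (\<Sum>a\<in>A. Poly_Mapping.lookup f a * h a)" for h
  proof (rule Sum_any.expand_superset)
    show "{a. Poly_Mapping.lookup f a * h a \<noteq> 0} \<subseteq> A"
      using assms(2) by (force simp: in_keys_iff subset_eq dest: mult_not_zero)
  qed fact
  ultimately have "Poly_Mapping.lookup (f * g) k =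
      (\<Sum>a\<in>A. Poly_Mapping.lookup f a * (\<Sum>b\<in>B. Poly_Mapping.lookup g b when k = a + b))"
    by (simp only: lookup_mult)
  then show ?thesis
    by (simp only: sum_distrib_left mult_when)
qed

instance poly_mapping :: (monoid_add, real_algebra_1) real_algebra_1
proof
  fix r :: real and f g :: "'a \<Rightarrow>\<^sub>0 'b"
  have keys: "Poly_Mapping.keys (scaleR r h) \<subseteq> Poly_Mapping.keys h" for h :: "'a \<Rightarrow>\<^sub>0 'b"
    by (auto simp: in_keys_iff)
  let ?A = "Poly_Mapping.keys f" and ?B = "Poly_Mapping.keys g"
  note exp = lookup_mult_superset[of ?A _ ?B]
  show "scaleR r f * g = scaleR r (f * g)" "f * scaleR r g = scaleR r (f * g)"
    by (auto intro!: poly_mapping_eqI sum.cong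
        simp: exp[OF finite_keys _ finite_keys] keys scaleR_sum_right when_def)
qed

definition z_pow :: "int \<Rightarrow> laurent"
  where "z_pow n = Poly_Mapping.single (of_int n, 0) 1"

definition w_pow :: "int \<Rightarrow> laurent"
  where "w_pow n = Poly_Mapping.single (0, of_int n) 1"

text \<open>\<open>J_series z_pow\<close> is $J(z)$ and \<open>J_series w_pow\<close> is $J(w)$.\<close>

definition J_series :: "(int \<Rightarrow> laurent) \<Rightarrow> (param, laurent) mps"
  where "J_series x = mps_exp
    (mps_suminf {1..} (\<lambda>k. mps_var (T k) * mps_const (x (int k))) -
     mps_suminf {1..} (\<lambda>k. mps_var (T' k) * mps_const (x (- int k))))"

text \<open>
  Product of a two-sided series in $z, w$ with a power series whose coefficients are Laurent
  polynomials in $z, w$.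
\<close>

definition series_times :: "(rat \<times> rat \<Rightarrow> complex) \<Rightarrow> (param, laurent) mps \<Rightarrow>
    rat \<times> rat \<Rightarrow> (param, complex) mps"
  where "series_times D F = (\<lambda>e. Mps (\<lambda>m.
    \<Sum>d\<in>Poly_Mapping.keys (coeff F m). D (e - d) * Poly_Mapping.lookup (coeff F m) d))"

end

theory Submission
  imports Defs
begin

text \<open>
  Put \<open>\<psi>(z) = \<Sum>z\<^sup>k \<psi>\<^sub>k\<close> and \<open>\<psi>\<^sup>*(w) = \<Sum>w\<^sup>-\<^sup>k \<psi>\<^sup>*\<^sub>k\<close>.  The canonical anticommutation relations make
  \<open>\<psi>(z) \<psi>\<^sup>*(w)\<close> an eigenvector of the commutator with \<open>\<alpha>\<^sub>n\<close>, with eigenvalue \<open>z\<^sup>n - w\<^sup>n\<close>.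
  Conjugation by an exponential of a combination of the \<open>\<alpha>\<^sub>n\<close> therefore multiplies
  \<open>\<psi>(z) \<psi>\<^sup>*(w)\<close> by the exponential of the same combination of the \<open>z\<^sup>n - w\<^sup>n\<close>; for \<open>G\<close> this
  factor is \<open>J(z) / J(w)\<close>.  What remains is the vacuum expectation of \<open>\<psi>(z) \<psi>\<^sup>*(w)\<close>, which is
  \<open>\<Sum>\<^sub>j (w / z)\<^sup>j\<close>.
\<close>

section \<open>Exponentials of formal power series\<close>

definition mdeg :: "('x \<Rightarrow>\<^sub>0 nat) \<Rightarrow> nat"
  where "mdeg m = Sum_any (Poly_Mapping.lookup m)"

lemma mdeg_add: "mdeg (a + b) = mdeg a + mdeg b"
  by (simp add: mdeg_def lookup_add Sum_any.distrib)

lemma mdeg_eq_0_iff: "mdeg m = 0 \<longleftrightarrow> m = 0"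
  unfolding mdeg_def Sum_any.expand_set
  by (auto simp: poly_mapping_eq_iff fun_eq_iff)

text \<open>The filtration by order of vanishing. If the \<open>i\<close>-th member of a family has
  order at least \<open>i\<close>, only finitely many members reach a given monomial, so infinite
  sums can be computed by truncation.\<close>

definition mps_ord_ge :: "nat \<Rightarrow> ('x, 'a::zero) mps \<Rightarrow> bool"
  where "mps_ord_ge n f \<longleftrightarrow> (\<forall>m. mdeg m < n \<longrightarrow> coeff f m = 0)"

lemma mps_ord_ge_1_iff: "mps_ord_ge 1 f \<longleftrightarrow> coeff f 0 = 0"
  by (auto simp: mps_ord_ge_def mdeg_eq_0_iff)

lemma mps_ord_ge_0 [simp]: "mps_ord_ge 0 f"
  by (simp add: mps_ord_ge_def)

lemma mps_ord_ge_mult: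
  fixes f g :: "('x, 'a::semiring_0) mps"
  assumes "mps_ord_ge k f" "mps_ord_ge l g"
  shows "mps_ord_ge (k + l) (f * g)"
  unfolding mps_ord_ge_def coeff_mult
proof (intro allI impI sum.neutral, clarify)
  fix m :: "'x \<Rightarrow>\<^sub>0 nat" and a b
  assume "mdeg m < k + l" "(a, b) \<in> splittings m"
  then have "mdeg a < k \<or> mdeg b < l"
    by (auto simp: splittings_def mdeg_add)
  with assms show "coeff f a * coeff g b = 0"
    by (auto simp: mps_ord_ge_def)
qed

lemma mps_ord_ge_diff:
  fixes f g :: "('x, 'a::ab_group_add) mps"
  shows "mps_ord_ge k f \<Longrightarrow> mps_ord_ge k g \<Longrightarrow> mps_ord_ge k (f - g)"
  by (simp add: mps_ord_ge_def)

lemma coeff_sum: "coeff (sum h I) m = (\<Sum>i\<in>I. coeff (h i) m)"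
  for h :: "'i \<Rightarrow> ('x, 'a::ab_group_add) mps"
  by (induction I rule: infinite_finite_induct) auto

lemma mps_ord_ge_scaleR:
  fixes f :: "('x, 'a::real_vector) mps"
  shows "mps_ord_ge k f \<Longrightarrow> mps_ord_ge k (r *\<^sub>R f)"
  by (simp add: mps_ord_ge_def)

lemma mps_ord_ge_power:
  fixes f :: "('x, 'a::ring_1) mps"
  assumes "mps_ord_ge 1 f"
  shows "mps_ord_ge k (f ^ k)"
proof (induction k)
  case (Suc k)
  show ?case
    using mps_ord_ge_mult[OF assms Suc] by simp
qed simp

text \<open>Members of index beyond the degree of \<open>m\<close> vanish at \<open>m\<close>. The
  bound \<open>N\<close> is left free so that one truncation serves all factors of a splitting at
  once.\<close>

lemma coeff_mps_suminf:
  assumes u: "\<And>i. mps_ord_ge i (u i)" and N: "mdeg m \<le> N"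
  shows "coeff (mps_suminf UNIV u) m = (\<Sum>i\<le>N. coeff (u i) m)"
  unfolding mps_suminf_def coeff_Mps
proof (rule sum.mono_neutral_left)
  show "{i \<in> UNIV. coeff (u i) m \<noteq> 0} \<subseteq> {..N}"
  proof clarsimp
    fix i
    assume "coeff (u i) m \<noteq> 0"
    then show "i \<le> N"
      using u[of i] N unfolding mps_ord_ge_def by (meson le_trans not_le)
  qed
qed auto

text \<open>The Cauchy product. At a fixed monomial both sums may be cut off at its degree, which
  leaves a finite square of index pairs to be regrouped along its diagonals.\<close>

lemma mps_suminf_mult:
  fixes u v :: "nat \<Rightarrow> ('x, 'a::ring_1) mps"
  assumes u: "\<And>i. mps_ord_ge i (u i)" and v: "\<And>i. mps_ord_ge i (v i)"
  shows "mps_suminf UNIV u * mps_suminf UNIV v =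
    mps_suminf UNIV (\<lambda>n. \<Sum>i\<le>n. u i * v (n - i))"
proof (rule mps_eqI)
  fix m :: "'x \<Rightarrow>\<^sub>0 nat"
  define N where "N = mdeg m"
  have uv: "mps_ord_ge n (\<Sum>i\<le>n. u i * v (n - i))" for n
  proof -
    have "mps_ord_ge n (u i * v (n - i))" if "i \<le> n" for i
      using mps_ord_ge_mult[OF u[of i] v[of "n - i"]] that by simp
    then show ?thesis
      by (simp add: mps_ord_ge_def coeff_sum)
  qed
  have "coeff (mps_suminf UNIV u * mps_suminf UNIV v) m =
      (\<Sum>(a, b)\<in>splittings m. (\<Sum>i\<le>N. coeff (u i) a) * (\<Sum>j\<le>N. coeff (v j) b))"
    unfolding coeff_mult
  proof (rule sum.cong[OF refl], clarify)
    fix a b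
    assume "(a, b) \<in> splittings m"
    then have "mdeg a \<le> N" "mdeg b \<le> N"
      by (auto simp: splittings_def N_def mdeg_add)
    then show "coeff (mps_suminf UNIV u) a * coeff (mps_suminf UNIV v) b =
        (\<Sum>i\<le>N. coeff (u i) a) * (\<Sum>j\<le>N. coeff (v j) b)"
      by (simp add: coeff_mps_suminf u v)
  qed
  also have "\<dots> = (\<Sum>p\<in>splittings m. \<Sum>(i, j)\<in>{..N} \<times> {..N}. coeff (u i) (fst p) * coeff (v j) (snd p))"
    by (simp add: sum_product sum.cartesian_product case_prod_beta)
  also have "\<dots> = (\<Sum>(i, j)\<in>{..N} \<times> {..N}. coeff (u i * v j) m)"
    by (subst sum.swap) (simp add: coeff_mult case_prod_beta)
  \<comment> \<open>Outside the triangle the order \<open>i + j\<close> of the product exceeds the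
    degree of \<open>m\<close>.\<close>
  also have "\<dots> = (\<Sum>(i, j)\<in>{(i, j). i + j \<le> N}. coeff (u i * v j) m)"
  proof (rule sum.mono_neutral_right)
    have "coeff (u i * v j) m = 0" if "N < i + j" for i j
      using mps_ord_ge_mult[OF u[of i] v[of j]] that by (simp add: mps_ord_ge_def N_def)
    then show "\<forall>p\<in>{..N} \<times> {..N} - {(i, j). i + j \<le> N}. (case p of (i, j) \<Rightarrow> coeff (u i * v j) m) = 0"
      by auto (meson not_le)
  qed auto
  also have "\<dots> = (\<Sum>n\<le>N. \<Sum>i\<le>n. coeff (u i * v (n - i)) m)"
    by (rule sum.triangle_reindex_eq)
  also have "\<dots> = coeff (mps_suminf UNIV (\<lambda>n. \<Sum>i\<le>n. u i * v (n - i))) m"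
    by (simp add: coeff_mps_suminf[OF uv, of m N] N_def coeff_sum)
  finally show "coeff (mps_suminf UNIV u * mps_suminf UNIV v) m =
      coeff (mps_suminf UNIV (\<lambda>n. \<Sum>i\<le>n. u i * v (n - i))) m" .
qed

text \<open>Each \<open>A\<close> that crosses \<open>Y\<close> either raises its index or leaves a
  \<open>B\<close> on the right; the binomial coefficient counts the ways to raise it
  \<open>i\<close> times.\<close>

lemma power_intertwine:
  fixes A B :: "'a::ring_1"
  assumes Y: "\<And>i. A * Y i = Y (Suc i) + Y i * B"
  shows "A ^ n * Y j = (\<Sum>i\<le>n. of_nat (n choose i) * (Y (i + j) * B ^ (n - i)))"
proof (induction n arbitrary: j)
  case (Suc n)
  \<comment> \<open>The factor next to \<open>Y j\<close> crosses first and may shift the index,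
    which is why the induction runs over arbitrary \<open>j\<close>.\<close>
  have "A ^ Suc n * Y j = A ^ n * Y (Suc j) + A ^ n * Y j * B"
    by (simp add: power_Suc2 mult.assoc Y distrib_left del: power_Suc)
  also have "A ^ n * Y (Suc j) =
      (\<Sum>i\<le>n. of_nat (n choose i) * (Y (Suc i + j) * B ^ (Suc n - Suc i)))"
    by (simp add: Suc)
  also have "A ^ n * Y j * B = (\<Sum>i\<le>n. of_nat (n choose i) * (Y (i + j) * B ^ (Suc n - i)))"
    unfolding Suc sum_distrib_right
    by (rule sum.cong) (auto simp: Suc_diff_le power_Suc2 mult.assoc simp del: power_Suc)
  also have "\<dots> = Y j * B ^ Suc n +
      (\<Sum>i\<le>n. of_nat (n choose Suc i) * (Y (Suc i + j) * B ^ (Suc n - Suc i)))"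
    \<comment> \<open>The sum is extended to \<open>i = Suc n\<close>, where
      \<open>n choose Suc n\<close> vanishes, and its term at 0 is split off; Pascal's rule then
      merges the two sums.\<close>
    using sum.atMost_Suc_shift[of "\<lambda>i. of_nat (n choose i) * (Y (i + j) * B ^ (Suc n - i))" n]
    by (simp add: binomial_eq_0)
  finally show ?case
    unfolding sum.atMost_Suc_shift
    by (simp add: sum.distrib distrib_right del: power_Suc)
qed simp

text \<open>
  For commuting \<open>C\<close>, \<open>B\<close>, \<open>A = C + B\<close> and \<open>Y i = C ^ i\<close> this is the addition theorem; for \<open>A = B\<close> it computes
  the conjugation of \<open>Y 0\<close> by \<open>exp A\<close>, with \<open>Y i\<close> the iterated commutators.
\<close>

lemma mps_exp_intertwine:
  fixes A B :: "('x, 'a::real_algebra_1) mps"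
  assumes A: "coeff A 0 = 0" and B: "coeff B 0 = 0"
    and Y: "\<And>i. A * Y i = Y (Suc i) + Y i * B"
  shows "mps_exp A * Y 0 = mps_suminf UNIV (\<lambda>i. Y i /\<^sub>R fact i) * mps_exp B"
proof -
  note ord = mps_ord_ge_1_iff[THEN iffD2]
  \<comment> \<open>Read as a recursion for \<open>Y\<close>, the hypothesis shows that every step
    gains an order, since \<open>A\<close> and \<open>B\<close> have no constant term; this makes
    the sum over \<open>Y i\<close> locally finite.\<close>
  have YA: "Y (Suc i) = A * Y i - Y i * B" for i
    by (simp add: Y)
  have ordY: "mps_ord_ge i (Y i)" for i
  proof (induction i)
    case (Suc i)
    show ?case
      unfolding YA using mps_ord_ge_mult[OF ord[OF A] Suc] mps_ord_ge_mult[OF Suc ord[OF B]]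
      by (simp add: mps_ord_ge_diff)
  qed simp
  have ordA: "mps_ord_ge i (A ^ i /\<^sub>R fact i)" and ordB: "mps_ord_ge i (B ^ i /\<^sub>R fact i)"
    and ordY': "mps_ord_ge i (Y i /\<^sub>R fact i)" for i
    by (auto intro: mps_ord_ge_scaleR mps_ord_ge_power ord A B ordY)
  have "A ^ n /\<^sub>R fact n * Y 0 = (\<Sum>i\<le>n. (Y i /\<^sub>R fact i) * (B ^ (n - i) /\<^sub>R fact (n - i)))" for n
  proof -
    have "A ^ n * Y 0 = (\<Sum>i\<le>n. (n choose i) *\<^sub>R (Y i * B ^ (n - i)))"
      using power_intertwine[of A Y B n 0, OF Y] by (simp add: scaleR_conv_of_real)
    then show ?thesis
      by (auto simp: scaleR_sum_right binomial_fact divide_simps intro!: sum.cong)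
  qed
  then have "mps_suminf UNIV (\<lambda>n. A ^ n /\<^sub>R fact n * Y 0) =
      mps_suminf UNIV (\<lambda>i. Y i /\<^sub>R fact i) * mps_exp B"
    by (simp add: mps_exp_def mps_suminf_mult[OF ordY' ordB])
  \<comment> \<open>\<open>Y 0\<close> is pulled out of the infinite sum: the degree of
    \<open>m\<close> bounds the degree of every left factor in a splitting of \<open>m\<close>, so
    one truncation suffices.\<close>
  moreover have "mps_suminf UNIV (\<lambda>n. A ^ n /\<^sub>R fact n * Y 0) = mps_exp A * Y 0"
  proof (rule mps_eqI)
    fix m :: "'x \<Rightarrow>\<^sub>0 nat"
    have "mps_ord_ge i (A ^ i /\<^sub>R fact i * Y 0)" for i
      using mps_ord_ge_mult[OF ordA, of 0 "Y 0" i] by simp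
    then have "coeff (mps_suminf UNIV (\<lambda>n. A ^ n /\<^sub>R fact n * Y 0)) m =
        (\<Sum>n\<le>mdeg m. coeff (A ^ n /\<^sub>R fact n * Y 0) m)"
      by (intro coeff_mps_suminf) auto
    also have "\<dots> = (\<Sum>(a, b)\<in>splittings m. (\<Sum>n\<le>mdeg m. coeff (A ^ n /\<^sub>R fact n) a) * coeff (Y 0) b)"
      by (simp only: coeff_mult case_prod_unfold sum_distrib_right) (rule sum.swap)
    also have "\<dots> = coeff (mps_exp A * Y 0) m"
      unfolding coeff_mult mps_exp_def
      by (rule sum.cong[OF refl])
        (auto simp: splittings_def mdeg_add coeff_mps_suminf[OF ordA, of _ "mdeg m"])
    finally show "coeff (mps_suminf UNIV (\<lambda>n. A ^ n /\<^sub>R fact n * Y 0)) m = coeff (mps_exp A * Y 0) m" .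
  qed
  ultimately show ?thesis
    by simp
qed

lemma mps_exp_add:
  fixes A B :: "('x, 'a::real_algebra_1) mps"
  assumes "coeff A 0 = 0" "coeff B 0 = 0" "A * B = B * A"
  shows "mps_exp (A + B) = mps_exp A * mps_exp B"
proof -
  have "A ^ i * B = B * A ^ i" for i
    using assms(3) by (metis power_commuting_commutes)
  then show ?thesis
    using mps_exp_intertwine[of "A + B" B "\<lambda>i. A ^ i"] assms
    by (simp add: distrib_right mps_exp_def)
qed

lemma mps_exp_0: "mps_exp (0 :: ('x, 'a::real_algebra_1) mps) = 1"
proof (rule mps_eqI)
  fix m :: "'x \<Rightarrow>\<^sub>0 nat"
  have "mps_ord_ge i ((0 :: ('x, 'a) mps) ^ i /\<^sub>R fact i)" for i
    by (cases i) (auto simp: mps_ord_ge_def)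
  then show "coeff (mps_exp 0) m = coeff (1 :: ('x, 'a) mps) m"
    unfolding mps_exp_def
    by (simp add: coeff_mps_suminf[where N = "mdeg m"] power_0_left sum.atMost_shift)
qed

section \<open>Inverses of exponentials, and linear exponents\<close>

lemma mps_exp_minus:
  fixes A :: "('x, 'a::real_algebra_1) mps"
  assumes "coeff A 0 = 0"
  shows "mps_exp A * mps_exp (- A) = 1" "mps_exp (- A) * mps_exp A = 1"
  using mps_exp_add[of A "- A"] mps_exp_add[of "- A" A] assms by (simp_all add: mps_exp_0)

lemma ring_inverse_eqI:
  fixes x y :: "'a::monoid_mult"
  assumes "x * y = 1" "y * x = 1"
  shows "ring_inverse x = y"
  unfolding ring_inverse_def
proof (rule the_equality)
  fix z
  assume "x * z = 1 \<and> z * x = 1"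
  then show "z = y"
    using assms by (metis mult.assoc mult_1_left mult_1_right)
qed (use assms in simp)

lemma ring_inverse_mps_exp:
  fixes A :: "('x, 'a::real_algebra_1) mps"
  shows "coeff A 0 = 0 \<Longrightarrow> ring_inverse (mps_exp A) = mps_exp (- A)"
  by (intro ring_inverse_eqI mps_exp_minus)

text \<open>The common shape of all exponents that occur: with operators \<open>c n\<close> those of
  \<open>Gamma_plus\<close> and \<open>Gamma_minus\<close>, with Laurent monomials
  \<open>c n\<close> the two sums in \<open>J_series\<close>.\<close>

definition linear_form :: "(nat \<Rightarrow> 'x) \<Rightarrow> (nat \<Rightarrow> 'a::ring_1) \<Rightarrow> ('x, 'a) mps"
  where "linear_form X c = mps_suminf {1..} (\<lambda>n. mps_var (X n) * mps_const (c n))"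

lemma coeff_var_mult_const:
  "coeff (mps_var x * mps_const c) m = (if m = Poly_Mapping.single x 1 then c else (0 :: 'a::ring_1))"
proof -
  have "coeff (mps_var x * mps_const c) m =
      (\<Sum>p\<in>splittings m. if p = (m, 0) then (if m = Poly_Mapping.single x 1 then c else 0) else 0)"
    unfolding coeff_mult
    by (rule sum.cong) (auto simp: splittings_def mps_var_def mps_const_def split: if_splits)
  also have "\<dots> = (if m = Poly_Mapping.single x 1 then c else 0)"
    by (simp add: sum.delta finite_splittings) (simp add: splittings_def)
  finally show ?thesis .
qed

lemma mps_const_mult:
  fixes a b :: "'a::semiring_0"
  shows "mps_const a * mps_const b = (mps_const (a * b) :: ('x, 'a) mps)"
proof (rule mps_eqI)
  fix m :: "'x \<Rightarrow>\<^sub>0 nat"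
  have "coeff (mps_const a * mps_const b) m =
      (\<Sum>p\<in>splittings m. if p = (m, 0) then coeff (mps_const (a * b)) m else 0)"
    unfolding coeff_mult
    by (rule sum.cong) (auto simp: splittings_def mps_const_def split: if_splits)
  also have "\<dots> = coeff (mps_const (a * b)) m"
    by (simp add: sum.delta finite_splittings) (simp add: splittings_def)
  finally show "coeff (mps_const a * mps_const b) m = coeff (mps_const (a * b)) m" .
qed

text \<open>Injectivity of \<open>X\<close> gives distinct indices distinct monomials, so a single
  member of the family contributes.\<close>

lemma coeff_linear_form_single:
  assumes "inj X" "1 \<le> n"
  shows "coeff (linear_form X c) (Poly_Mapping.single (X n) 1) = c n"
proof -
  have "X n = X k \<longleftrightarrow> n = k" for k
    using assms(1) by (auto dest: injD)
  then have "Poly_Mapping.single (X n) (1::nat) = Poly_Mapping.single (X k) 1 \<longleftrightarrow> n = k" for k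
    by (metis lookup_single_eq lookup_single_not_eq zero_neq_one)
  then have *: "coeff (mps_var (X k) * mps_const (c k)) (Poly_Mapping.single (X n) 1) =
      (if k = n then c n else 0)" for k
    by (auto simp: coeff_var_mult_const)
  have "{k \<in> {1..}. (if k = n then c n else 0) \<noteq> 0} = (if c n = 0 then {} else {n})"
    using assms(2) by auto
  then show ?thesis
    unfolding linear_form_def mps_suminf_def coeff_Mps * by simp
qed

lemma coeff_linear_form_other:
  assumes "\<not> (\<exists>n\<ge>1. m = Poly_Mapping.single (X n) 1)"
  shows "coeff (linear_form X c) m = 0"
  unfolding linear_form_def mps_suminf_def coeff_Mps
  using assms by (auto simp: coeff_var_mult_const if_distrib cong: if_cong intro!: sum.neutral)

lemma coeff_linear_form_0 [simp]: "coeff (linear_form X c) 0 = 0"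
  by (rule coeff_linear_form_other) (metis lookup_single_eq lookup_zero zero_neq_one)

section \<open>Anticommutation relations\<close>

definition wedge_sign :: "rat \<Rightarrow> maya \<Rightarrow> complex"
  where "wedge_sign k S = (- 1) ^ card {s \<in> maya_set S. k < s}"

lemma wedge_sign_square [simp]: "wedge_sign k S * wedge_sign k S = 1"
  by (simp add: wedge_sign_def flip: power_mult_distrib)

text \<open>Makes the cardinality in \<open>wedge_sign\<close> a genuine count rather than the
  default 0: there are finitely many nonnegative elements, and the negative ones lie between
  \<open>k\<close> and 0.\<close>

lemma finite_maya_above: "finite {s \<in> maya_set S. k < s}"
proof (rule finite_subset)
  show "{s \<in> maya_set S. k < s} \<subseteq> (maya_set S - neg_half_ints) \<union> {s \<in> half_ints. k < s \<and> s < 0}"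
    using maya_set[of S] by (auto simp: neg_half_ints_def)
  show "finite ((maya_set S - neg_half_ints) \<union> {s \<in> half_ints. k < s \<and> s < 0})"
    using maya_set[of S] finite_half_ints_between by auto
qed

definition maya_ins :: "rat \<Rightarrow> maya \<Rightarrow> maya"
  where "maya_ins k S = Maya (insert k (maya_set S))"

definition maya_del :: "rat \<Rightarrow> maya \<Rightarrow> maya"
  where "maya_del k S = Maya (maya_set S - {k})"

lemma maya_set_ins [simp]: "k \<in> half_ints \<Longrightarrow> maya_set (maya_ins k S) = insert k (maya_set S)"
  by (simp add: maya_ins_def maya_insert)

lemma maya_set_del [simp]: "maya_set (maya_del k S) = maya_set S - {k}"
  by (simp add: maya_del_def maya_remove)

lemma maya_eqI: "maya_set S = maya_set S' \<Longrightarrow> S = S'"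
  by (simp add: maya_set_inject)

text \<open>The origin of anticommutation: for \<open>k \<noteq> l\<close> exactly one of
  \<open>k < l\<close> and \<open>l < k\<close> holds, so acting in the two orders produces opposite
  signs.\<close>

lemma wedge_sign_ins:
  assumes "l \<in> half_ints" "l \<notin> maya_set S"
  shows "wedge_sign k (maya_ins l S) = (if k < l then - wedge_sign k S else wedge_sign k S)"
proof -
  have "{s \<in> insert l (maya_set S). k < s} =
      (if k < l then insert l {s \<in> maya_set S. k < s} else {s \<in> maya_set S. k < s})"
    by auto
  then show ?thesis
    using assms finite_maya_above[of S k] by (simp add: wedge_sign_def)
qed

lemma wedge_sign_del:
  assumes "l \<in> maya_set S"
  shows "wedge_sign k (maya_del l S) = (if k < l then - wedge_sign k S else wedge_sign k S)"
proof -
  have l: "l \<in> half_ints"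
    using assms maya_set[of S] by auto
  have "maya_ins l (maya_del l S) = S"
    using assms l by (intro maya_eqI) auto
  then show ?thesis
    using wedge_sign_ins[OF l, of "maya_del l S" k] by simp
qed

lemma psi_basis:
  "op_apply (psi k) (wedge_basis S) =
    (if k \<in> maya_set S then 0 else wedge_scale (wedge_sign k S) (wedge_basis (maya_ins k S)))"
  by (simp add: psi.rep_eq wedge_insert_def wedge_sign_def maya_ins_def)

lemma psi_star_basis:
  "k \<in> half_ints \<Longrightarrow> op_apply (psi_star k) (wedge_basis S) =
    (if k \<in> maya_set S then wedge_scale (wedge_sign k S) (wedge_basis (maya_del k S)) else 0)"
  by (simp add: psi_star_eq psi_star_explicit.rep_eq wedge_sign_def maya_del_def)

lemma wedge_op_eqI_basis:
  assumes "\<And>S. op_apply A (wedge_basis S) = op_apply B (wedge_basis S)"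
  shows "A = B"
proof (rule wedge_op_eqI)
  fix f
  show "op_apply A f = op_apply B f"
    by (subst (1 2) wedge_expand) (simp add: op_apply_sum op_apply_scale assms)
qed

lemma wedge_scale_scale [simp]: "wedge_scale a (wedge_scale b f) = wedge_scale (a * b) f"
  by (rule poly_mapping_eqI) simp

lemma wedge_scale_1 [simp]: "wedge_scale 1 f = f"
  by (rule poly_mapping_eqI) simp

lemma wedge_scale_minus_left [simp]: "wedge_scale (- a) f = - wedge_scale a f"
  by (rule poly_mapping_eqI) simp

lemmas op_apply_ring = times_wedge_op.rep_eq plus_wedge_op.rep_eq minus_wedge_op.rep_eq
  uminus_wedge_op.rep_eq zero_wedge_op.rep_eq one_wedge_op.rep_eq

lemmas wedge_action = op_apply_ring psi_basis psi_star_basis op_apply_scale op_apply_zero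
  wedge_sign_ins wedge_sign_del

lemma psi_psi_anticommute:
  assumes "k \<in> half_ints" "l \<in> half_ints"
  shows "psi k * psi l = - (psi l * psi k)"
proof (rule wedge_op_eqI_basis)
  fix S
  have "maya_ins k (maya_ins l S) = maya_ins l (maya_ins k S)"
    using assms by (intro maya_eqI) auto
  then show "op_apply (psi k * psi l) (wedge_basis S) = op_apply (- (psi l * psi k)) (wedge_basis S)"
    using assms by (auto simp: wedge_action mult.commute)
qed

lemma psi_star_psi_star_anticommute:
  assumes "k \<in> half_ints" "l \<in> half_ints"
  shows "psi_star k * psi_star l = - (psi_star l * psi_star k)"
proof (rule wedge_op_eqI_basis)
  fix S
  have "maya_del k (maya_del l S) = maya_del l (maya_del k S)"
    by (intro maya_eqI) auto
  then show "op_apply (psi_star k * psi_star l) (wedge_basis S) =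
      op_apply (- (psi_star l * psi_star k)) (wedge_basis S)"
    using assms by (auto simp: wedge_action mult.commute)
qed

text \<open>For \<open>k = l\<close> exactly one of the two products survives on a basis vector, and
  its two equal signs multiply to 1. For \<open>k \<noteq> l\<close> both orders lead to the same
  set with opposite signs.\<close>

lemma psi_star_psi_anticommute:
  assumes "k \<in> half_ints" "l \<in> half_ints"
  shows "psi_star k * psi l = (if k = l then 1 else 0) - psi l * psi_star k"
proof (rule wedge_op_eqI_basis)
  fix S
  show "op_apply (psi_star k * psi l) (wedge_basis S) =
      op_apply ((if k = l then 1 else 0) - psi l * psi_star k) (wedge_basis S)"
  proof (cases "k = l")
    case True
    have "maya_del l (maya_ins l S) = S" if "l \<notin> maya_set S"
      using assms that by (intro maya_eqI) auto
    moreover have "maya_ins l (maya_del l S) = S" if "l \<in> maya_set S"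
      using assms that by (intro maya_eqI) auto
    ultimately show ?thesis
      using assms True by (auto simp: wedge_action)
  next
    case False
    then have "maya_del k (maya_ins l S) = maya_ins l (maya_del k S)"
      using assms by (intro maya_eqI) auto
    with False show ?thesis
      using assms by (auto simp: wedge_action mult.commute)
  qed
qed

section \<open>Commutators with \<open>alpha\<close>\<close>

lemma commutator_mult:
  fixes a x y :: "'a::ring"
  shows "a * (x * y) - (x * y) * a = (a * x - x * a) * y + x * (a * y - y * a)"
  by (simp add: algebra_simps)

text \<open>Passing \<open>psi k\<close> across two fermionic factors costs two signs, which cancel;
  only its contraction with \<open>psi_star l\<close> remains.\<close>

lemma bilinear_psi_commutator:
  assumes "k \<in> half_ints" "l \<in> half_ints" "m \<in> half_ints"
  shows "psi m * psi_star l * psi k - psi k * (psi m * psi_star l) = (if l = k then psi m else 0)"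
proof -
  have "psi m * psi_star l * psi k = psi m * ((if l = k then 1 else 0) - psi k * psi_star l)"
    by (simp only: mult.assoc psi_star_psi_anticommute[OF assms(2,1)])
  moreover have "psi k * (psi m * psi_star l) = - (psi m * (psi k * psi_star l))"
    using psi_psi_anticommute[OF assms(1,3)] by (metis minus_mult_left mult.assoc)
  ultimately show ?thesis
    by (simp add: right_diff_distrib)
qed

text \<open>Here the contraction is with \<open>psi m\<close>; it arises in the subtracted product,
  hence the minus sign.\<close>

lemma bilinear_psi_star_commutator:
  assumes "k \<in> half_ints" "l \<in> half_ints" "m \<in> half_ints"
  shows "psi m * psi_star l * psi_star k - psi_star k * (psi m * psi_star l) =
    (if k = m then - psi_star l else 0)"
proof -
  have "psi_star k * (psi m * psi_star l) = ((if k = m then 1 else 0) - psi m * psi_star k) * psi_star l"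
    by (simp only: mult.assoc[symmetric] psi_star_psi_anticommute[OF assms(1,3)])
  moreover have "psi m * psi_star l * psi_star k = - (psi m * psi_star k * psi_star l)"
    using psi_star_psi_star_anticommute[OF assms(2,1)] by (simp add: mult.assoc)
  ultimately show ?thesis
    by (simp add: left_diff_distrib)
qed

text \<open>The index set in \<open>alpha_apply\<close> depends on the vector; a common finite
  superset allows sums at different vectors to be subtracted termwise.\<close>

lemma alpha_apply_superset:
  assumes "n \<noteq> 0" "finite L" "L \<subseteq> half_ints"
    "{k \<in> half_ints. op_apply (psi (k - of_int n) * psi_star k) f \<noteq> 0} \<subseteq> L"
  shows "op_apply (alpha n) f = (\<Sum>k\<in>L. op_apply (psi (k - of_int n) * psi_star k) f)"
  unfolding alpha_apply[OF assms(1)] using assms(2-)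
  by (intro sum.mono_neutral_left) auto

lemma alpha_commutator:
  assumes n: "n \<noteq> 0" and k: "k \<in> half_ints"
    and comm: "\<And>l. l \<in> half_ints \<Longrightarrow>
      psi (l - of_int n) * psi_star l * X - X * (psi (l - of_int n) * psi_star l) =
      (if l = k then Y else 0)"
  shows "alpha n * X - X * alpha n = Y"
proof (rule wedge_op_eqI)
  fix f
  let ?P = "\<lambda>l. psi (l - of_int n) * psi_star l"
  let ?N = "\<lambda>f. {l \<in> half_ints. op_apply (?P l) f \<noteq> 0}"
  \<comment> \<open>One product applies \<open>alpha n\<close> to \<open>f\<close>, the other to
    \<open>X f\<close>, so both supports are collected; \<open>k\<close> is added so that the
    surviving term is always in range.\<close>
  define L where "L = insert k (?N f \<union> ?N (op_apply X f))"
  have L: "finite L" "L \<subseteq> half_ints" "?N f \<subseteq> L" "?N (op_apply X f) \<subseteq> L" "k \<in> L"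
    using finite_alpha_summands[OF n] k by (auto simp: L_def)
  have "op_apply (alpha n * X - X * alpha n) f = (\<Sum>l\<in>L. op_apply (?P l * X - X * ?P l) f)"
    using alpha_apply_superset[OF n L(1,2,3)] alpha_apply_superset[OF n L(1,2,4)]
    by (simp add: op_apply_ring op_apply_sum sum_subtractf)
  also have "\<dots> = (\<Sum>l\<in>L. if l = k then op_apply Y f else 0)"
    using L(2) by (intro sum.cong) (auto simp: comm zero_wedge_op.rep_eq)
  also have "\<dots> = op_apply Y f"
    using L by (simp add: sum.delta)
  finally show "op_apply (alpha n * X - X * alpha n) f = op_apply Y f" .
qed

lemma alpha_psi_commutator:
  assumes "n \<noteq> 0" "k \<in> half_ints"
  shows "alpha n * psi k - psi k * alpha n = psi (k - of_int n)"
proof (rule alpha_commutator[OF assms])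
  fix l assume l: "l \<in> half_ints"
  show "psi (l - of_int n) * psi_star l * psi k - psi k * (psi (l - of_int n) * psi_star l) =
      (if l = k then psi (k - of_int n) else 0)"
    using bilinear_psi_commutator[OF assms(2) l half_ints_diff[OF l, of n]] by auto
qed

lemma half_ints_add: "k \<in> half_ints \<Longrightarrow> k + of_int n \<in> half_ints"
  using half_ints_diff[of k "- n"] by simp

lemma alpha_psi_star_commutator:
  assumes "n \<noteq> 0" "k \<in> half_ints"
  shows "alpha n * psi_star k - psi_star k * alpha n = - psi_star (k + of_int n)"
\<comment> \<open>\<open>psi_star k\<close> contracts with \<open>psi (l - of_int n)\<close>, so the
  surviving summand is the one at \<open>l = k + of_int n\<close>.\<close>
proof (rule alpha_commutator[OF assms(1) half_ints_add[OF assms(2), of n]])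
  fix l assume l: "l \<in> half_ints"
  show "psi (l - of_int n) * psi_star l * psi_star k - psi_star k * (psi (l - of_int n) * psi_star l) =
      (if l = k + of_int n then - psi_star (k + of_int n) else 0)"
    using bilinear_psi_star_commutator[OF assms(2) l half_ints_diff[OF l, of n]]
    by (auto simp: algebra_simps)
qed

text \<open>The index \<open>- b\<close> appears because \<open>psi_star k\<close> carries
  \<open>w^(-k)\<close>. The value 0 off the half-integers allows shifts by arbitrary rational
  exponents.\<close>

definition psi_psi_star :: "rat \<times> rat \<Rightarrow> wedge_op"
  where "psi_psi_star = (\<lambda>(a, b). if a \<in> half_ints \<and> b \<in> half_ints then psi a * psi_star (- b) else 0)"

lemma half_ints_minus_iff [simp]: "- k \<in> half_ints \<longleftrightarrow> k \<in> half_ints"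
proof -
  have "- k \<in> half_ints" if k: "k \<in> half_ints" for k
  proof -
    obtain n :: int where "k = of_int n + 1 / 2"
      using k by (auto simp: half_ints_def)
    then show ?thesis
      unfolding half_ints_def by (intro image_eqI[of _ _ "- n - 1"]) auto
  qed
  from this[of k] this[of "- k"] show ?thesis
    by auto
qed

lemma half_ints_diff_iff [simp]: "k - of_int n \<in> half_ints \<longleftrightarrow> k \<in> half_ints"
  using half_ints_diff[of k n] half_ints_add[of "k - of_int n" n] by auto

text \<open>The eigenvalue \<open>z^n - w^n\<close> read off at \<open>z^a w^b\<close>: multiplying
  by \<open>z^n\<close> or \<open>w^n\<close> lowers the index \<open>a\<close> or \<open>b\<close>
  by \<open>n\<close>. It follows from the Leibniz rule.\<close>

lemma alpha_psi_psi_star_commutator: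
  assumes "n \<noteq> 0"
  shows "alpha n * psi_psi_star (a, b) - psi_psi_star (a, b) * alpha n =
    psi_psi_star (a - of_int n, b) - psi_psi_star (a, b - of_int n)"
proof (cases "a \<in> half_ints \<and> b \<in> half_ints")
  case True
  then show ?thesis
    using assms alpha_psi_commutator[of n a] alpha_psi_star_commutator[of n "- b"]
    by (simp add: psi_psi_star_def commutator_mult)
qed (auto simp: psi_psi_star_def)

text \<open>\<open>psi_star (- b)\<close> kills the vacuum unless \<open>- b\<close> is one of its
  negative half-integers; \<open>psi a\<close> must then refill that very hole, and the two equal
  signs cancel.\<close>

lemma vacuum_psi_psi_star:
  "wedge_inner (op_apply (psi_psi_star e) vacuum) vacuum = sqrt_zw_over_diff e"
proof (cases e)
  case (Pair a b)
  define V where "V = Maya neg_half_ints"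
  have V: "maya_set V = neg_half_ints"
    unfolding V_def by (rule Maya_inverse) (auto simp: neg_half_ints_def)
  have zero: "b \<noteq> 0" if b: "b \<in> half_ints"
  proof -
    obtain n :: int where n: "b = of_int n + 1 / 2"
      using b by (auto simp: half_ints_def)
    show ?thesis
    proof
      assume "b = 0"
      with n have "of_int (2 * n) = (of_int (- 1) :: rat)"
        by simp
      then have "2 * n = - 1"
        by (simp only: of_int_eq_iff)
      then show False
        by presburger
    qed
  qed
  show ?thesis
  proof (cases "a \<in> half_ints \<and> b \<in> half_ints \<and> 0 < b")
    case True
    then have b: "- b \<in> half_ints" "- b \<in> maya_set V"
      by (auto simp: V neg_half_ints_def)
    have eq: "maya_ins a (maya_del (- b) V) = V \<longleftrightarrow> a = - b"
    proof
      assume "maya_ins a (maya_del (- b) V) = V"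
      then have "insert a (maya_set V - {- b}) = maya_set V"
        using True maya_set_ins[of a "maya_del (- b) V"] by simp
      with b(2) show "a = - b"
        by (metis Diff_iff insertE singletonI)
    next
      assume "a = - b"
      then have "maya_set (maya_ins a (maya_del (- b) V)) = maya_set V"
        using True b by (simp add: insert_absorb)
      then show "maya_ins a (maya_del (- b) V) = V"
        by (rule maya_eqI)
    qed
    have "op_apply (psi_psi_star e) vacuum = wedge_scale (wedge_sign (- b) V)
        (op_apply (psi a) (wedge_basis (maya_del (- b) V)))"
      using True b unfolding Pair vacuum_def V_def[symmetric]
      by (simp add: psi_psi_star_def times_wedge_op.rep_eq psi_star_basis op_apply_scale)
    also have "\<dots> = (if a \<in> maya_set V - {- b} then 0 else
        wedge_scale (wedge_sign (- b) V * wedge_sign a (maya_del (- b) V))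
          (wedge_basis (maya_ins a (maya_del (- b) V))))"
      by (simp add: psi_basis)
    finally have *: "op_apply (psi_psi_star e) vacuum = \<dots>" .
    have "Poly_Mapping.lookup (op_apply (psi_psi_star e) vacuum) V = (if a = - b then 1 else 0)"
      using b(2) eq wedge_sign_del[OF b(2), of a]
      by (auto simp: * wedge_basis_def[of "maya_ins _ _"] lookup_single when_def)
    then show ?thesis
      unfolding vacuum_def V_def[symmetric] wedge_inner_basis_right
      using True by (simp add: Pair sqrt_zw_over_diff_def vacuum_def V_def)
  next
    case False
    have "op_apply (psi_psi_star e) vacuum = 0"
    proof (cases "a \<in> half_ints \<and> b \<in> half_ints")
      case True
      with False have "- b \<notin> maya_set V"
        using zero by (auto simp: V neg_half_ints_def)
      with True show ?thesis
        unfolding Pair vacuum_def V_def[symmetric]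
        by (simp add: psi_psi_star_def times_wedge_op.rep_eq psi_star_basis op_apply_zero)
    qed (auto simp: Pair psi_psi_star_def zero_wedge_op.rep_eq)
    moreover have "a \<in> half_ints" if "b \<in> half_ints" "a = - b"
      using that by simp
    ultimately show ?thesis
      using False by (auto simp: Pair sqrt_zw_over_diff_def wedge_inner_def)
  qed
qed

section \<open>Conjugation by exponentials\<close>

text \<open>Operators form an algebra over the reals only, so the complex coefficients of Laurent
  polynomials are embedded as central operators.\<close>

lift_definition scalar_op :: "complex \<Rightarrow> wedge_op" is wedge_scale
  by (auto simp: linear_wedge_iff lookup_add algebra_simps intro!: poly_mapping_eqI)

lemma scalar_op_simps:
  "scalar_op 0 = 0" "scalar_op 1 = 1"
  "scalar_op (a + b) = scalar_op a + scalar_op b"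
  "scalar_op (- a) = - scalar_op a"
  "scalar_op (a * b) = scalar_op a * scalar_op b"
  "scalar_op (scaleR r a) = scaleR r (scalar_op a)"
  by (transfer; auto simp: fun_eq_iff lookup_add algebra_simps scaleR_conv_of_real intro!: poly_mapping_eqI)+

lemma scalar_op_commute: "A * scalar_op c = scalar_op c * A"
  by transfer (auto simp: linear_wedge_iff)

lemma scalar_op_sum: "scalar_op (sum h I) = (\<Sum>i\<in>I. scalar_op (h i))"
  by (induction I rule: infinite_finite_induct) (auto simp: scalar_op_simps)

section \<open>Laurent polynomials acting on the generating function\<close>

text \<open>
  The product of a Laurent polynomial with the generating function
  \<open>\<psi>(z) \<psi>\<^sup>*(w) = \<Sum>z\<^sup>a w\<^sup>b psi_psi_star (a, b)\<close>, read off at the exponent \<open>e\<close>.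
\<close>

definition laurent_act :: "laurent \<Rightarrow> rat \<times> rat \<Rightarrow> wedge_op"
  where "laurent_act p e =
    (\<Sum>d\<in>Poly_Mapping.keys p. scalar_op (Poly_Mapping.lookup p d) * psi_psi_star (e - d))"

lemma laurent_act_superset:
  assumes "finite D" "Poly_Mapping.keys p \<subseteq> D"
  shows "laurent_act p e = (\<Sum>d\<in>D. scalar_op (Poly_Mapping.lookup p d) * psi_psi_star (e - d))"
  unfolding laurent_act_def using assms
  by (intro sum.mono_neutral_left) (auto simp: in_keys_iff scalar_op_simps)

lemma laurent_act_0 [simp]: "laurent_act 0 e = 0"
  by (simp add: laurent_act_def)

lemma laurent_act_single: "laurent_act (Poly_Mapping.single d 1) e = psi_psi_star (e - d)"
  by (simp add: laurent_act_def scalar_op_simps)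

lemma laurent_act_1: "laurent_act 1 e = psi_psi_star e"
  using laurent_act_single[of 0 e] by simp

lemma laurent_act_add: "laurent_act (p + q) e = laurent_act p e + laurent_act q e"
proof -
  let ?D = "Poly_Mapping.keys p \<union> Poly_Mapping.keys q \<union> Poly_Mapping.keys (p + q)"
  show ?thesis
    using laurent_act_superset[of ?D p e] laurent_act_superset[of ?D q e]
      laurent_act_superset[of ?D "p + q" e]
    by (simp add: lookup_add scalar_op_simps distrib_right sum.distrib subset_eq)
qed

lemma laurent_act_uminus: "laurent_act (- p) e = - laurent_act p e"
  using laurent_act_add[of p "- p" e] by (simp add: add_eq_0_iff)

lemma laurent_act_diff: "laurent_act (p - q) e = laurent_act p e - laurent_act q e"
  using laurent_act_add[of p "- q" e] by (simp add: laurent_act_uminus)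

lemma laurent_act_sum: "laurent_act (sum h I) e = (\<Sum>i\<in>I. laurent_act (h i) e)"
  by (induction I rule: infinite_finite_induct) (auto simp: laurent_act_add)

lemma laurent_act_scaleR: "laurent_act (scaleR r p) e = scaleR r (laurent_act p e)"
proof -
  have "Poly_Mapping.keys (scaleR r p) \<subseteq> Poly_Mapping.keys p"
    by (auto simp: in_keys_iff)
  from laurent_act_superset[OF finite_keys this, of e] show ?thesis
    by (simp add: laurent_act_def scalar_op_simps scaleR_sum_right)
qed

text \<open>Multiplication by \<open>p * q\<close> is multiplication by \<open>p\<close> followed by
  \<open>q\<close>; the convolution collapses at \<open>k = a + b\<close>.\<close>

lemma laurent_act_mult:
  "laurent_act (p * q) e =
    (\<Sum>b\<in>Poly_Mapping.keys q. scalar_op (Poly_Mapping.lookup q b) * laurent_act p (e - b))"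
proof -
  let ?A = "Poly_Mapping.keys p" and ?B = "Poly_Mapping.keys q"
  let ?p = "Poly_Mapping.lookup p" and ?q = "Poly_Mapping.lookup q"
  define K where "K = {a + b |a b. a \<in> ?A \<and> b \<in> ?B}"
  have K: "finite K" "Poly_Mapping.keys (p * q) \<subseteq> K"
    using finite_image_set2[of "\<lambda>a. a \<in> ?A" "\<lambda>b. b \<in> ?B" "(+)"] keys_mult[of p q]
    by (simp_all only: K_def Collect_mem_eq finite_keys)
  have "laurent_act (p * q) e = (\<Sum>k\<in>K. \<Sum>a\<in>?A. \<Sum>b\<in>?B.
      if k = a + b then scalar_op (?p a * ?q b) * psi_psi_star (e - k) else 0)"
    unfolding laurent_act_superset[OF K] lookup_mult_superset[OF finite_keys subset_refl finite_keys subset_refl]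
      scalar_op_sum sum_distrib_right
    by (intro sum.cong refl) (auto simp: when_def scalar_op_simps)
  also have "\<dots> = (\<Sum>b\<in>?B. \<Sum>a\<in>?A. \<Sum>k\<in>K.
      if k = a + b then scalar_op (?p a * ?q b) * psi_psi_star (e - k) else 0)"
    by (subst sum.swap, subst sum.swap[of _ K], subst sum.swap) simp
  also have "\<dots> = (\<Sum>b\<in>?B. \<Sum>a\<in>?A. scalar_op (?p a * ?q b) * psi_psi_star (e - (a + b)))"
    using K(1) by (intro sum.cong refl) (auto simp: K_def sum.delta)
  also have "\<dots> = (\<Sum>b\<in>?B. scalar_op (?q b) * laurent_act p (e - b))"
    unfolding laurent_act_def sum_distrib_left
    by (intro sum.cong refl) (simp add: scalar_op_simps(5)[symmetric] mult.assoc[symmetric] algebra_simps)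
  finally show ?thesis .
qed

text \<open>Scalars commute with \<open>A\<close>, so the eigenvalue relation survives
  multiplication of the generating function by \<open>q\<close>.\<close>

lemma commutator_laurent_act:
  assumes "\<And>e. A * psi_psi_star e - psi_psi_star e * A = laurent_act p e"
  shows "A * laurent_act q e - laurent_act q e * A = laurent_act (p * q) e"
  unfolding laurent_act_mult
  by (simp add: laurent_act_def[of q] sum_distrib_left sum_distrib_right sum_subtractf[symmetric]
      mult.assoc assms[symmetric] right_diff_distrib)
    (simp add: mult.assoc[symmetric] scalar_op_commute)

section \<open>Power series acting on the generating function\<close>

definition mps_act :: "(param, laurent) mps \<Rightarrow> rat \<times> rat \<Rightarrow> (param, wedge_op) mps"
  where "mps_act F e = Mps (\<lambda>m. laurent_act (coeff F m) e)"

lemma coeff_mps_act [simp]: "coeff (mps_act F e) m = laurent_act (coeff F m) e"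
  by (simp add: mps_act_def)

lemma mps_act_1: "mps_act 1 e = mps_const (psi_psi_star e)"
  by (rule mps_eqI) (simp add: coeff_one mps_const_def laurent_act_1)

text \<open>The generating function is an eigenvector of the commutator with \<open>A\<close>, with
  eigenvalue \<open>f\<close>. The parameters are central, so this can be stated monomial by
  monomial; zero constant terms make both exponentials meaningful.\<close>

definition acts_as :: "(param, wedge_op) mps \<Rightarrow> (param, laurent) mps \<Rightarrow> bool"
  where "acts_as A f \<longleftrightarrow> coeff A 0 = 0 \<and> coeff f 0 = 0 \<and>
    (\<forall>m e. coeff A m * psi_psi_star e - psi_psi_star e * coeff A m = laurent_act (coeff f m) e)"

text \<open>Arranged as the hypothesis of \<open>mps_exp_intertwine\<close> with
  \<open>B = A\<close> and \<open>Y i = mps_act (f ^ i * F) e\<close>.\<close>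

lemma acts_as_mps_act:
  assumes "acts_as A f"
  shows "A * mps_act F e = mps_act (f * F) e + mps_act F e * A"
proof -
  have "A * mps_act F e - mps_act F e * A = mps_act (f * F) e"
  proof (rule mps_eqI)
    fix m :: "param \<Rightarrow>\<^sub>0 nat"
    \<comment> \<open>Only the summation indices are exchanged, not the noncommuting factors, so
      that both products run over the same splittings.\<close>
    have swap: "(\<Sum>(a, b)\<in>splittings m. h b a) = (\<Sum>(a, b)\<in>splittings m. h a b)"
      for h :: "_ \<Rightarrow> _ \<Rightarrow> wedge_op"
      by (rule sum.reindex_bij_witness[where i = prod.swap and j = prod.swap])
        (auto simp: splittings_def add.commute)
    have "coeff (mps_act F e * A) m =
        (\<Sum>(a, b)\<in>splittings m. laurent_act (coeff F b) e * coeff A a)"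
      using swap[of "\<lambda>a b. laurent_act (coeff F a) e * coeff A b"] by (simp add: coeff_mult)
    then have "coeff (A * mps_act F e - mps_act F e * A) m = (\<Sum>(a, b)\<in>splittings m.
        coeff A a * laurent_act (coeff F b) e - laurent_act (coeff F b) e * coeff A a)"
      by (simp add: coeff_mult case_prod_unfold sum_subtractf)
    also have "\<dots> = (\<Sum>(a, b)\<in>splittings m. laurent_act (coeff f a * coeff F b) e)"
      using assms by (intro sum.cong refl) (auto simp: acts_as_def intro!: commutator_laurent_act)
    also have "\<dots> = coeff (mps_act (f * F) e) m"
      by (simp add: coeff_mult laurent_act_sum case_prod_unfold)
    finally show "coeff (A * mps_act F e - mps_act F e * A) m = coeff (mps_act (f * F) e) m" .
  qed
  then show ?thesis
    by (simp add: algebra_simps)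
qed

text \<open>Iterated commutators with \<open>A\<close> multiply by powers of \<open>f\<close>, so
  conjugation by \<open>mps_exp A\<close> multiplies by \<open>mps_exp f\<close>.\<close>

lemma mps_exp_mps_act:
  assumes "acts_as A f"
  shows "mps_exp A * mps_act F e = mps_act (mps_exp f * F) e * mps_exp A"
proof -
  have A: "coeff A 0 = 0" and f: "coeff f 0 = 0"
    using assms by (auto simp: acts_as_def)
  have "mps_exp A * mps_act (f ^ 0 * F) e =
      mps_suminf UNIV (\<lambda>i. mps_act (f ^ i * F) e /\<^sub>R fact i) * mps_exp A"
    by (rule mps_exp_intertwine[OF A A]) (simp add: acts_as_mps_act[OF assms] mult.assoc)
  moreover have "mps_suminf UNIV (\<lambda>i. mps_act (f ^ i * F) e /\<^sub>R fact i) = mps_act (mps_exp f * F) e"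
  proof (rule mps_eqI)
    fix m :: "param \<Rightarrow>\<^sub>0 nat"
    have pow: "mps_ord_ge i (f ^ i)" for i
      using f by (intro mps_ord_ge_power) (simp only: mps_ord_ge_1_iff)
    then have ord: "mps_ord_ge i (f ^ i /\<^sub>R fact i)" for i
      by (rule mps_ord_ge_scaleR)
    have "mps_ord_ge i (f ^ i * F)" for i
      using mps_ord_ge_mult[OF pow, of 0 F i] by simp
    then have "mps_ord_ge i (mps_act (f ^ i * F) e /\<^sub>R fact i)" for i
      by (simp add: mps_ord_ge_def)
    then have "coeff (mps_suminf UNIV (\<lambda>i. mps_act (f ^ i * F) e /\<^sub>R fact i)) m =
        (\<Sum>i\<le>mdeg m. laurent_act (coeff (f ^ i /\<^sub>R fact i * F) m) e)"
      by (subst coeff_mps_suminf[where N = "mdeg m"]) (auto simp: laurent_act_scaleR)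
    also have "\<dots> = laurent_act (\<Sum>(a, b)\<in>splittings m.
        (\<Sum>i\<le>mdeg m. coeff (f ^ i /\<^sub>R fact i) a) * coeff F b) e"
      by (simp only: laurent_act_sum[symmetric] coeff_mult case_prod_unfold sum_distrib_right)
        (subst sum.swap, rule refl)
    also have "\<dots> = coeff (mps_act (mps_exp f * F) e) m"
      unfolding coeff_mps_act coeff_mult mps_exp_def
      by (intro arg_cong2[where f = laurent_act] sum.cong refl)
        (auto simp: splittings_def mdeg_add coeff_mps_suminf[OF ord, of _ "mdeg m"])
    finally show "coeff (mps_suminf UNIV (\<lambda>i. mps_act (f ^ i * F) e /\<^sub>R fact i)) m =
        coeff (mps_act (mps_exp f * F) e) m" .
  qed
  ultimately show ?thesis
    by simp
qed

section \<open>The exponents of \<open>G_op\<close> and the factor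
  \<open>J(z) / J(w)\<close>\<close>

lemma acts_as_uminus: "acts_as A f \<Longrightarrow> acts_as (- A) (- f)"
  unfolding acts_as_def by (simp add: laurent_act_uminus) (metis minus_diff_eq)

text \<open>Treats both exponents at once: \<open>s = 1\<close> for \<open>Gamma_plus\<close>,
  \<open>s = - 1\<close> for \<open>Gamma_minus\<close>. At the monomial of \<open>X n\<close> it is
  the commutator with \<open>alpha (s * int n)\<close>; elsewhere both sides vanish.\<close>

lemma acts_as_linear_form:
  assumes X: "inj X" and s: "s = 1 \<or> s = - 1"
  shows "acts_as (linear_form X (\<lambda>n. alpha (s * int n)))
    (linear_form X (\<lambda>n. z_pow (s * int n)) - linear_form X (\<lambda>n. w_pow (s * int n)))"
  unfolding acts_as_def
proof (intro conjI allI)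
  fix m :: "param \<Rightarrow>\<^sub>0 nat" and e :: "rat \<times> rat"
  show "coeff (linear_form X (\<lambda>n. alpha (s * int n))) m * psi_psi_star e -
      psi_psi_star e * coeff (linear_form X (\<lambda>n. alpha (s * int n))) m =
      laurent_act (coeff (linear_form X (\<lambda>n. z_pow (s * int n)) -
        linear_form X (\<lambda>n. w_pow (s * int n))) m) e"
  proof (cases "\<exists>n\<ge>1. m = Poly_Mapping.single (X n) 1")
    case True
    then obtain n where n: "1 \<le> n" "m = Poly_Mapping.single (X n) 1"
      by blast
    then have "s * int n \<noteq> 0"
      using s by auto
    from alpha_psi_psi_star_commutator[OF this, of "fst e" "snd e"] show ?thesis
      unfolding n(2) coeff_diff coeff_linear_form_single[OF X n(1)]
      by (simp add: laurent_act_diff z_pow_def w_pow_def laurent_act_single minus_prod_def)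
  next
    case False
    show ?thesis
      by (simp only: coeff_diff coeff_linear_form_other[OF False]) simp
  qed
qed simp_all

text \<open>Series over Laurent polynomials commute, so the exponents add and can be regrouped by
  parameter family, matching the two factors of \<open>G_op\<close>.\<close>

lemma J_ratio:
  "J_series z_pow * ring_inverse (J_series w_pow) =
    mps_exp (linear_form T (\<lambda>n. z_pow (int n)) - linear_form T (\<lambda>n. w_pow (int n))) *
    mps_exp (- (linear_form T' (\<lambda>n. z_pow (- int n)) - linear_form T' (\<lambda>n. w_pow (- int n))))"
proof -
  have "J_series x = mps_exp (linear_form T (\<lambda>n. x (int n)) - linear_form T' (\<lambda>n. x (- int n)))" for x
    by (simp only: J_series_def linear_form_def)
  then show ?thesis
    by (simp add: ring_inverse_mps_exp mps_exp_add[symmetric] mult.commute)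
      (simp add: algebra_simps)
qed

text \<open>The two exponentials in \<open>G_op\<close> pass the generating function one after the
  other, first contributing \<open>mps_exp (- g)\<close>, then \<open>mps_exp f\<close>.\<close>

lemma G_op_conjugation:
  "\<exists>H. ring_inverse G_op = H \<and> G_op * H = 1 \<and> H * G_op = 1 \<and>
    G_op * mps_const (psi_psi_star e) * H =
      mps_act (J_series z_pow * ring_inverse (J_series w_pow)) e"
proof -
  define A where "A = linear_form T (\<lambda>n. alpha (int n))"
  define B where "B = linear_form T' (\<lambda>n. alpha (- int n))"
  define f where "f = linear_form T (\<lambda>n. z_pow (int n)) - linear_form T (\<lambda>n. w_pow (int n))"
  define g where "g = linear_form T' (\<lambda>n. z_pow (- int n)) - linear_form T' (\<lambda>n. w_pow (- int n))"
  have "acts_as A f" "acts_as B g"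
    using acts_as_linear_form[of T 1] acts_as_linear_form[of T' "- 1"]
    by (simp_all add: A_def B_def f_def g_def inj_def)
  note act = mps_exp_mps_act[OF this(1)] mps_exp_mps_act[OF acts_as_uminus, OF this(2)]
  have A: "coeff A 0 = 0" and B: "coeff B 0 = 0"
    by (simp_all add: A_def B_def)
  have G: "G_op = mps_exp A * mps_exp (- B)"
    using ring_inverse_mps_exp[OF B]
    by (simp add: G_op_def Gamma_plus_def Gamma_minus_def A_def B_def linear_form_def)
  \<comment> \<open>The inverses of the two factors in reverse order, since \<open>A\<close> and
    \<open>B\<close> need not commute.\<close>
  define H where "H = mps_exp B * mps_exp (- A)"
  have "G_op * H = mps_exp A * (mps_exp (- B) * mps_exp B) * mps_exp (- A)"
    "H * G_op = mps_exp B * (mps_exp (- A) * mps_exp A) * mps_exp (- B)"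
    by (simp_all only: G H_def mult.assoc)
  then have GH: "G_op * H = 1" "H * G_op = 1"
    by (simp_all add: mps_exp_minus A B)
  have "G_op * mps_const (psi_psi_star e) = mps_exp A * (mps_exp (- B) * mps_act 1 e)"
    by (simp add: G mps_act_1 mult.assoc)
  also have "\<dots> = mps_act (mps_exp f * mps_exp (- g)) e * G_op"
    by (simp add: act G mult.assoc[symmetric])
  finally have "G_op * mps_const (psi_psi_star e) * H = mps_act (mps_exp f * mps_exp (- g)) e"
    by (simp add: mult.assoc GH)
  with GH ring_inverse_eqI[OF GH] show ?thesis
    by (auto simp: J_ratio f_def g_def)
qed

text \<open>The inner \<open>H * G_op\<close> cancels, leaving the conjugate of the product.\<close>

lemma Psi_Psi_star:
  assumes "a \<in> half_ints" "b \<in> half_ints"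
  shows "Psi a * Psi_star (- b) = mps_act (J_series z_pow * ring_inverse (J_series w_pow)) (a, b)"
proof -
  obtain H where H: "ring_inverse G_op = H" "G_op * H = 1" "H * G_op = 1"
    "G_op * mps_const (psi_psi_star (a, b)) * H =
      mps_act (J_series z_pow * ring_inverse (J_series w_pow)) (a, b)"
    using G_op_conjugation by blast
  have "Psi a * Psi_star (- b) = G_op * mps_const (psi a) * (H * G_op) * mps_const (psi_star (- b)) * H"
    by (simp only: Psi_def Psi_star_def H(1) mult.assoc)
  also have "\<dots> = G_op * mps_const (psi_psi_star (a, b)) * H"
    using assms by (simp add: H(3) mult.assoc psi_psi_star_def flip: mps_const_mult)
  finally show ?thesis
    by (simp only: H(4))
qed

text \<open>Conjugating a zero coefficient gives zero. This matches the zero values of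
  \<open>kernel_gf\<close>, as \<open>series_times\<close> itself does not single out
  half-integers.\<close>

lemma mps_act_J_off_half_ints:
  assumes "\<not> (a \<in> half_ints \<and> b \<in> half_ints)"
  shows "mps_act (J_series z_pow * ring_inverse (J_series w_pow)) (a, b) = 0"
proof -
  have "mps_const (psi_psi_star (a, b)) = (0 :: (param, wedge_op) mps)"
    using assms by (auto intro!: mps_eqI simp: psi_psi_star_def mps_const_def)
  then show ?thesis
    using G_op_conjugation[of "(a, b)"] by auto
qed

lemma wedge_inner_laurent_act_vacuum:
  "wedge_inner (op_apply (laurent_act p e) vacuum) vacuum =
    (\<Sum>d\<in>Poly_Mapping.keys p. sqrt_zw_over_diff (e - d) * Poly_Mapping.lookup p d)"
proof -
  \<comment> \<open>Pairing with the vacuum reads off one coordinate, so it is linear in the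
    operator.\<close>
  have vac: "wedge_inner f vacuum = Poly_Mapping.lookup f (Maya neg_half_ints)" for f
    by (simp add: vacuum_def)
  have sum: "op_apply (sum h I) v = (\<Sum>i\<in>I. op_apply (h i) v)" for h :: "rat \<times> rat \<Rightarrow> wedge_op" and I v
    by (induction I rule: infinite_finite_induct) (auto simp: op_apply_ring)
  show ?thesis
    by (simp add: vac laurent_act_def sum lookup_sum times_wedge_op.rep_eq scalar_op.rep_eq
        vacuum_psi_psi_star[unfolded vac] mult.commute)
qed

theorem theorem2:
  shows "kernel_gf =
    series_times sqrt_zw_over_diff (J_series z_pow * ring_inverse (J_series w_pow))"
proof
  fix e :: "rat \<times> rat"
  let ?F = "J_series z_pow * ring_inverse (J_series w_pow)"
  obtain a b where e: "e = (a, b)"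
    by (cases e)
  \<comment> \<open>A description valid at every exponent, to which the vacuum expectation applies
    coefficientwise.\<close>
  have "kernel_gf e = Mps (\<lambda>m. wedge_inner (op_apply (coeff (mps_act ?F e) m) vacuum) vacuum)"
  proof (cases "a \<in> half_ints \<and> b \<in> half_ints")
    case True
    then show ?thesis
      by (simp only: kernel_gf_def kernel_K_def e prod.case if_True Psi_Psi_star simp_thms)
  next
    case False
    then have "kernel_gf e = 0"
      by (auto simp: kernel_gf_def e)
    moreover have "mps_act ?F e = 0"
      using mps_act_J_off_half_ints[OF False] by (simp only: e)
    ultimately show ?thesis
      by (simp add: zero_wedge_op.rep_eq wedge_inner_def zero_mps_def)
  qed
  then show "kernel_gf e = series_times sqrt_zw_over_diff ?F e"
    by (simp add: series_times_def wedge_inner_laurent_act_vacuum)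
qed

end
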